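(* Let $M,N\in\mathcal{LC}$ be such that $\mu_p\le C\nu_p$ for some $C\ge1$ and all $p\in\mathbb{N}$, $M$ satisfies (mg), and $\gamma(M,N)>0$. Put $\widehat{M}=(p!M_p)_{p\in\mathbb{N}}$, $\widehat{N}=(p!N_p)_{p\in\mathbb{N}}$ and let $0<\gamma<\gamma(M,N)$. Then there exists a constant $k_1>0$ such that for every $h>0$ there is a linear and continuous map $$E^{M,N}_h:\ \Lambda_{\widehat{M},h}\to\mathcal{A}_{\widehat{N},k_1h}(S_\gamma),\qquad\lambda\mapsto f_\lambda,$$ such that $\mathcal{B}(f_\lambda)=\lambda$ for every $\lambda\in\Lambda_{\widehat{M},h}$. Thus $\mathcal{B}(\mathcal{A}_{\{\widehat{N}\}}(S_\gamma))\supseteq\Lambda_{\{\widehat{M}\}}$.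
   Context: $\mathbb{N}=\{0,1,2,\dots\}$. For a sequence $M=(M_k)_{k\in\mathbb{N}}$ of positive reals put $\mu_0:=1$, $\mu_k:=M_k/M_{k-1}$ for $k\ge1$; similarly $\nu_k$ denotes the quotients of $N$. $\mathcal{LC}$ is the set of all sequences $M$ of positive reals that are normalized ($1=M_0\le M_1$), log-convex ($M_j^2\le M_{j-1}M_{j+1}$ for all $j\ge1$) and satisfy $\lim_{k\to\infty}(M_k)^{1/k}=+\infty$. $M$ satisfies (mg) (moderate growth) if there is $C\ge1$ with $M_{j+k}\le C^{j+k}M_jM_k$ for all $j,k\in\mathbb{N}$. Mixed growth index: if $\mu_p\le C\nu_p$ for all $p$, condition $(M,N)_{\gamma_r}$ ($r>0$) means $\sup_{p\ge1}\frac{(\mu_p)^{1/r}}{p}\sum_{k\ge p}\left(\frac{1}{\nu_k}\right)^{1/r}<+\infty$, and $\gamma(M,N):=\sup\{r>0:(M,N)_{\gamma_r}\text{ holds}\}\in[0,+\infty]$ ($0$ if there is no such $r$). Let $\mathcal{R}$ be the Riemann surface of the logarithm and $S_\gamma:=\{z\in\mathcal{R}:|\arg(z)|<\gamma\pi/2\}$. For a sequence $M$ of positive reals, $h>0$ and a sector $S$, $\mathcal{A}_{M,h}(S)$ is the Banach space of holomorphic $f$ on $S$ with $\|f\|_{M,h}:=\sup_{z\in S,p\in\mathbb{N}}\frac{|f^{(p)}(z)|}{h^pM_p}<\infty$, and $\Lambda_{M,h}$ is the Banach space of complex sequences $a$ with $|a|_{M,h}:=\sup_{p\in\mathbb N}\frac{|a_p|}{h^pM_p}<\infty$;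 $\mathcal{A}_{\{M\}}(S):=\bigcup_{h>0}\mathcal{A}_{M,h}(S)$, $\Lambda_{\{M\}}:=\bigcup_{h>0}\Lambda_{M,h}$. The Borel map is $\mathcal{B}(f):=(f^{(p)}(0))_{p\in\mathbb{N}}$ with $f^{(p)}(0):=\lim_{z\in S,\,z\to0}f^{(p)}(z)$. *)

theory Defs
  imports "HOL-Analysis.Analysis"
begin

section \<open>Weight sequences\<close>

definition quot :: "(nat \<Rightarrow> real) \<Rightarrow> nat \<Rightarrow> real" where
  "quot M k = (if k = 0 then 1 else M k / M (k - 1))"

definition LC :: "(nat \<Rightarrow> real) set" where
  "LC = {M. (\<forall>k. 0 < M k) \<and> M 0 = 1 \<and> 1 \<le> M 1
           \<and> (\<forall>j\<ge>1. (M j)\<^sup>2 \<le> M (j - 1) * M (j + 1))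
           \<and> filterlim (\<lambda>k. M k powr (1 / real k)) at_top sequentially}"

definition moderate_growth :: "(nat \<Rightarrow> real) \<Rightarrow> bool" where
  "moderate_growth M \<longleftrightarrow> (\<exists>C\<ge>1. \<forall>j k. M (j + k) \<le> C ^ (j + k) * M j * M k)"

(* Finiteness of the supremum includes convergence of the series, which is a separate conjunct
   because suminf is also defined for divergent series. *)
definition gamma_cond :: "(nat \<Rightarrow> real) \<Rightarrow> (nat \<Rightarrow> real) \<Rightarrow> real \<Rightarrow> bool" where
  "gamma_cond M N r \<longleftrightarrow>
     summable (\<lambda>k. (1 / quot N k) powr (1 / r)) \<and>
     bdd_above ((\<lambda>p. quot M p powr (1 / r) / real p
                      * (\<Sum>k. (1 / quot N (p + k)) powr (1 / r))) ` {1..})"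

(* Inserting 0 gives the value 0 when the condition holds for no r > 0. *)
definition growth_index :: "(nat \<Rightarrow> real) \<Rightarrow> (nat \<Rightarrow> real) \<Rightarrow> ereal" where
  "growth_index M N = Sup (insert 0 (ereal ` {r. 0 < r \<and> gamma_cond M N r}))"

definition fact_mult :: "(nat \<Rightarrow> real) \<Rightarrow> nat \<Rightarrow> real" where
  "fact_mult M p = fact p * M p"


section \<open>The Riemann surface of the logarithm\<close>

text \<open>
  The surface is the universal covering of the punctured plane. A point z is represented by its
  logarithm w, so that the covering projection is exp, and the point has modulus
  cmod (exp w) and argument Im w. Holomorphy and derivatives are taken with respect to the local
  coordinate exp w (that is, z itself), not with respect to w.
\<close>

type_synonym log_surface = complex

definition proj :: "log_surface \<Rightarrow> complex" where
  "proj w = exp w"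

definition argument :: "log_surface \<Rightarrow> real" where
  "argument w = Im w"

definition sector :: "real \<Rightarrow> log_surface set" where
  "sector \<gamma> = {w. \<bar>argument w\<bar> < \<gamma> * pi / 2}"

definition surf_has_deriv :: "(log_surface \<Rightarrow> complex) \<Rightarrow> complex \<Rightarrow> log_surface \<Rightarrow> bool" where
  "surf_has_deriv f D w \<longleftrightarrow> ((\<lambda>u. (f u - f w) / (proj u - proj w)) \<longlongrightarrow> D) (at w)"

definition surf_deriv :: "(log_surface \<Rightarrow> complex) \<Rightarrow> log_surface \<Rightarrow> complex" where
  "surf_deriv f w = (THE D. surf_has_deriv f D w)"

(* Only used for open S. *)
definition surf_holomorphic_on :: "(log_surface \<Rightarrow> complex) \<Rightarrow> log_surface set \<Rightarrow> bool" where
  "surf_holomorphic_on f S \<longleftrightarrow> (\<forall>w\<in>S. \<exists>D. surf_has_deriv f D w)"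

(* The filter of z tending to 0 inside S, where 0 is not a point of the surface. *)
definition to_zero_in :: "log_surface set \<Rightarrow> log_surface filter" where
  "to_zero_in S = inf (filtercomap proj (nhds 0)) (principal S)"

lemma surf_has_deriv_iff:
  "surf_has_deriv f D w \<longleftrightarrow> (f has_field_derivative (exp w * D)) (at w)"
proof -
  let ?q = "\<lambda>u. (exp u - exp w) / (u - w)"
  have q: "(?q \<longlongrightarrow> exp w) (at w)"
    using DERIV_exp[of w] by (simp add: has_field_derivative_iff)
  have ne: "eventually (\<lambda>u. exp u - exp w \<noteq> 0 \<and> u - w \<noteq> 0) (at w)"
  proof -
    have "eventually (\<lambda>u. ?q u \<noteq> 0) (at w)"
      using q by (rule tendsto_imp_eventually_ne) simp
    then show ?thesis by eventually_elim auto
  qed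
  show ?thesis
  proof
    assume "surf_has_deriv f D w"
    then have "((\<lambda>u. ?q u * ((f u - f w) / (exp u - exp w))) \<longlongrightarrow> exp w * D) (at w)"
      unfolding surf_has_deriv_def proj_def by (intro tendsto_mult q)
    moreover have "eventually (\<lambda>u. ?q u * ((f u - f w) / (exp u - exp w)) = (f u - f w) / (u - w)) (at w)"
      using ne by eventually_elim (simp add: divide_simps)
    ultimately show "(f has_field_derivative (exp w * D)) (at w)"
      unfolding has_field_derivative_iff by (rule Lim_transform_eventually)
  next
    assume "(f has_field_derivative (exp w * D)) (at w)"
    then have "((\<lambda>u. ((f u - f w) / (u - w)) / ?q u) \<longlongrightarrow> (exp w * D) / exp w) (at w)"
      unfolding has_field_derivative_iff by (intro tendsto_divide q exp_not_eq_zero)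
    then have "((\<lambda>u. ((f u - f w) / (u - w)) / ?q u) \<longlongrightarrow> D) (at w)"
      by simp
    moreover have "eventually (\<lambda>u. ((f u - f w) / (u - w)) / ?q u = (f u - f w) / (exp u - exp w)) (at w)"
      using ne by eventually_elim (simp add: divide_simps)
    ultimately show "surf_has_deriv f D w"
      unfolding surf_has_deriv_def proj_def by (rule Lim_transform_eventually)
  qed
qed

lemma surf_holomorphic_on_iff:
  assumes "open S"
  shows "surf_holomorphic_on f S \<longleftrightarrow> f holomorphic_on S"
proof -
  have "(\<exists>D. surf_has_deriv f D w) \<longleftrightarrow> f field_differentiable (at w)" for w
  proof
    assume "\<exists>D. surf_has_deriv f D w"
    then obtain D where "surf_has_deriv f D w" ..
    then show "f field_differentiable (at w)"
      unfolding surf_has_deriv_iff field_differentiable_def by (rule exI)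
  next
    assume "f field_differentiable (at w)"
    then obtain d where "(f has_field_derivative d) (at w)"
      unfolding field_differentiable_def ..
    then have "surf_has_deriv f (d / exp w) w"
      by (simp add: surf_has_deriv_iff)
    then show "\<exists>D. surf_has_deriv f D w" ..
  qed
  moreover have "at w within S = at w" if "w \<in> S" for w
    using that assms by (rule at_within_open)
  ultimately show ?thesis
    by (simp add: surf_holomorphic_on_def holomorphic_on_def)
qed


section \<open>Weighted spaces and the Borel map\<close>

definition seq_norm :: "(nat \<Rightarrow> real) \<Rightarrow> real \<Rightarrow> (nat \<Rightarrow> complex) \<Rightarrow> real" where
  "seq_norm M h a = (SUP p. cmod (a p) / (h ^ p * M p))"

definition seq_space :: "(nat \<Rightarrow> real) \<Rightarrow> real \<Rightarrow> (nat \<Rightarrow> complex) set" where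
  "seq_space M h = {a. bdd_above (range (\<lambda>p. cmod (a p) / (h ^ p * M p)))}"

definition seq_space_union :: "(nat \<Rightarrow> real) \<Rightarrow> (nat \<Rightarrow> complex) set" where
  "seq_space_union M = (\<Union>h\<in>{0<..}. seq_space M h)"

definition fun_norm :: "(nat \<Rightarrow> real) \<Rightarrow> real \<Rightarrow> log_surface set \<Rightarrow> (log_surface \<Rightarrow> complex) \<Rightarrow> real" where
  "fun_norm M h S f = (SUP (w, p) \<in> S \<times> UNIV. cmod ((surf_deriv ^^ p) f w) / (h ^ p * M p))"

(* A function on S is represented by its extension by 0, so that equality in the space is
   equality of functions on S. *)
definition fun_space :: "(nat \<Rightarrow> real) \<Rightarrow> real \<Rightarrow> log_surface set \<Rightarrow> (log_surface \<Rightarrow> complex) set" where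
  "fun_space M h S =
     {f. surf_holomorphic_on f S \<and> (\<forall>w. w \<notin> S \<longrightarrow> f w = 0) \<and>
         bdd_above ((\<lambda>(w, p). cmod ((surf_deriv ^^ p) f w) / (h ^ p * M p)) ` (S \<times> UNIV))}"

definition fun_space_union :: "(nat \<Rightarrow> real) \<Rightarrow> log_surface set \<Rightarrow> (log_surface \<Rightarrow> complex) set" where
  "fun_space_union M S = (\<Union>h\<in>{0<..}. fun_space M h S)"

definition has_boundary_derivs ::
    "log_surface set \<Rightarrow> (log_surface \<Rightarrow> complex) \<Rightarrow> (nat \<Rightarrow> complex) \<Rightarrow> bool" where
  "has_boundary_derivs S f a \<longleftrightarrow> (\<forall>p. ((surf_deriv ^^ p) f \<longlongrightarrow> a p) (to_zero_in S))"

(* Lim is a definite description, meaningful only where the limit exists; has_boundary_derivs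
   asserts that existence. *)
definition borel_map :: "log_surface set \<Rightarrow> (log_surface \<Rightarrow> complex) \<Rightarrow> nat \<Rightarrow> complex" where
  "borel_map S f p = Lim (to_zero_in S) ((surf_deriv ^^ p) f)"


section \<open>Continuous linear maps between spaces of functions\<close>

definition clinear_between ::
    "('i \<Rightarrow> complex) set \<Rightarrow> ('j \<Rightarrow> complex) set \<Rightarrow> (('i \<Rightarrow> complex) \<Rightarrow> ('j \<Rightarrow> complex)) \<Rightarrow> bool" where
  "clinear_between V W E \<longleftrightarrow>
     (\<forall>a\<in>V. E a \<in> W) \<and>
     (\<forall>a\<in>V. \<forall>b\<in>V. E (\<lambda>i. a i + b i) = (\<lambda>j. E a j + E b j)) \<and>
     (\<forall>c. \<forall>a\<in>V. E (\<lambda>i. c * a i) = (\<lambda>j. c * E a j))"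

definition norm_continuous_on ::
    "('i \<Rightarrow> complex) set \<Rightarrow> (('i \<Rightarrow> complex) \<Rightarrow> real) \<Rightarrow> (('j \<Rightarrow> complex) \<Rightarrow> real) \<Rightarrow>
     (('i \<Rightarrow> complex) \<Rightarrow> ('j \<Rightarrow> complex)) \<Rightarrow> bool" where
  "norm_continuous_on V nV nW E \<longleftrightarrow>
     (\<forall>a\<in>V. \<forall>e>0. \<exists>d>0. \<forall>b\<in>V. nV (\<lambda>i. b i - a i) < d \<longrightarrow> nW (\<lambda>j. E b j - E a j) < e)"

end

theory Submission
  imports Defs "HOL-Complex_Analysis.Complex_Analysis" "HOL-Real_Asymp.Real_Asymp"
begin

text \<open>
  Choose \<open>r > \<gamma>\<close> with the growth condition \<open>(M,N)\<close> of exponent \<open>r\<close>, and write \<open>\<mu>\<close> and \<open>\<nu>\<close> for the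
  quotients of \<open>M\<close> and \<open>N\<close>. The extension is a truncated Laplace transform with the explicit kernel
  \<open>G(z) = ((1 + z\<^sup>1\<^sup>/\<^sup>r) \<Prod>k. (1 + (z / \<nu>\<^sub>k)\<^sup>1\<^sup>/\<^sup>r))\<^sup>-\<^sup>r\<close>, \<open>k \<ge> 0\<close>, on the sector of opening \<open>r\<close>, where
  \<open>z\<^sup>1\<^sup>/\<^sup>r\<close> lies in the right half-plane.

  Since \<open>|1 + \<zeta>| \<ge> max 1 |\<zeta>|\<close> for \<open>Re \<zeta> > 0\<close>, the kernel satisfies
  \<open>|G(z)| \<le> N\<^sub>n |z|\<^sup>-\<^sup>n min 1 (|z|\<^sup>-\<^sup>2)\<close> for every \<open>n\<close> (\<open>norm_kernel_le\<close>). On the positive axis \<open>G\<close>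
  decreases, and the growth condition bounds it from below at the point \<open>\<mu>\<^sub>p\<close>
  (\<open>kernel_real_lower_bound\<close>). With moderate growth of \<open>M\<close> this shows that the moments
  \<open>m\<^sub>p = \<integral> t\<^sup>p G(t) dt\<close> satisfy \<open>m\<^sub>p \<ge> c A\<^sup>p M\<^sub>p\<close> (\<open>moments_lower_bound\<close>).

  For \<open>|a\<^sub>p| \<le> L p! M\<^sub>p\<close> put \<open>f(z) = \<Sum>p. (a\<^sub>p / p!) z\<^sup>p (P\<^sub>p(R / z) / m\<^sub>p)\<close>, where \<open>P\<^sub>p(x)\<close> is the incomplete
  moment \<open>\<integral> t\<^sup>p G(t) dt\<close> from \<open>0\<close> to \<open>x\<close> and \<open>R = A / 2\<close>. In the remainder
  \<open>f(z) - (\<Sum>p<n. (a\<^sub>p / p!) z\<^sup>p)\<close> the terms with \<open>p \<ge> n\<close> contain \<open>P\<^sub>p(R / z)\<close> and those with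
  \<open>p < n\<close> contain the upper part \<open>m\<^sub>p - P\<^sub>p(R / z)\<close> of the integral. Both are at most
  \<open>\<pi> N\<^sub>n |R / z|\<^sup>p\<^sup>-\<^sup>n\<close> (\<open>incomplete_moments\<close>), and summation shows that the remainder is at most a
  constant times \<open>L N\<^sub>n |z / R|\<^sup>n\<close> (\<open>extension_remainder\<close>). Cauchy's inequality in discs whose radius
  is proportional to \<open>|z|\<close> turns this into the bounds for the derivatives in the smaller sector of
  opening \<open>\<gamma>\<close> and into their limits at \<open>0\<close> (\<open>surf_deriv_Cauchy\<close>). A dilation gives the case of
  arbitrary \<open>h\<close>.

  All functions are handled in the logarithmic coordinate \<open>w\<close> with \<open>z = e\<^sup>w\<close>, in which a sector is
  a horizontal strip and the incomplete moments are primitives.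
\<close>

section \<open>Derivatives on the surface\<close>

lemma open_sector: "open (sector \<gamma>)"
  unfolding sector_def argument_def by (intro open_Collect_less continuous_intros)

lemma convex_sector: "convex (sector \<gamma>)"
proof -
  have "sector \<gamma> = {w. Im w < \<gamma> * pi / 2} \<inter> {w. Im w > - (\<gamma> * pi / 2)}"
    by (auto simp: sector_def argument_def)
  then show ?thesis
    by (simp only: convex_Int convex_halfspace_Im_lt convex_halfspace_Im_gt)
qed

lemma surf_deriv_eq:
  assumes "(f has_field_derivative D) (at w)"
  shows "surf_deriv f w = D / exp w"
  unfolding surf_deriv_def surf_has_deriv_iff
proof (rule the_equality)
  show "(f has_field_derivative exp w * (D / exp w)) (at w)"
    using assms by simp
  show "d = D / exp w" if "(f has_field_derivative exp w * d) (at w)" for d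
    using DERIV_unique[OF assms that] by simp
qed

lemma surf_deriv_cong:
  assumes "open S" "\<And>w. w \<in> S \<Longrightarrow> f w = g w" "w \<in> S"
  shows "(surf_deriv ^^ n) f w = (surf_deriv ^^ n) g w"
  using assms(3)
proof (induction n arbitrary: w)
  case (Suc n)
  have "surf_has_deriv ((surf_deriv ^^ n) f) D w = surf_has_deriv ((surf_deriv ^^ n) g) D w" for D
    unfolding surf_has_deriv_iff
    using eventually_nhds_in_open[OF assms(1) Suc.prems]
    by (intro DERIV_cong_ev) (auto elim!: eventually_mono simp: Suc.IH)
  then have "surf_deriv ((surf_deriv ^^ n) f) w = surf_deriv ((surf_deriv ^^ n) g) w"
    by (simp only: surf_deriv_def[of "(surf_deriv ^^ n) f" w] surf_deriv_def[of "(surf_deriv ^^ n) g" w])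
  then show ?case by simp
qed (use assms in simp)

lemma surf_deriv_holomorphic:
  assumes "f holomorphic_on S" "open S"
  shows "surf_deriv f holomorphic_on S"
proof -
  have "(\<lambda>w. deriv f w / exp w) holomorphic_on S"
    using assms by (intro holomorphic_intros) auto
  moreover have "surf_deriv f w = deriv f w / exp w" if "w \<in> S" for w
    using assms that by (intro surf_deriv_eq holomorphic_derivI)
  ultimately show ?thesis
    by (simp cong: holomorphic_cong)
qed

text \<open>Read in the coordinate \<open>z\<close>, by means of a branch \<open>\<psi>\<close> of the logarithm, the iterated
  derivatives on the surface are ordinary iterated derivatives. This makes Cauchy's inequality
  available.\<close>

lemma surf_deriv_chart:
  assumes "f holomorphic_on S" "open S" "open T" "\<psi> holomorphic_on T" "\<psi> ` T \<subseteq> S"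
    and inv: "\<And>z. z \<in> T \<Longrightarrow> exp (\<psi> z) = z" and "z \<in> T"
  shows "(surf_deriv ^^ n) f (\<psi> z) = (deriv ^^ n) (\<lambda>z. f (\<psi> z)) z"
  using assms(1)
proof (induction n arbitrary: f)
  case 0
  then show ?case by simp
next
  case (Suc n)
  have hol: "(\<lambda>z. g (\<psi> z)) holomorphic_on T" if "g holomorphic_on S" for g
    using holomorphic_on_compose_gen[OF assms(4) that assms(5)] by (simp add: o_def)
  have der: "surf_deriv f (\<psi> u) = deriv (\<lambda>z. f (\<psi> z)) u" if u: "u \<in> T" for u
  proof -
    have 1: "(\<psi> has_field_derivative deriv \<psi> u) (at u)"
      using assms u by (intro holomorphic_derivI)
    have 2: "(f has_field_derivative deriv f (\<psi> u)) (at (\<psi> u))"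
      using assms u Suc.prems by (intro holomorphic_derivI) auto
    have "((\<lambda>z. exp (\<psi> z)) has_field_derivative exp (\<psi> u) * deriv \<psi> u) (at u)"
      using 1 by (auto intro!: derivative_eq_intros)
    then have "((\<lambda>z. z) has_field_derivative exp (\<psi> u) * deriv \<psi> u) (at u)"
      by (rule has_field_derivative_transform_within_open[OF _ assms(3) u inv])
    then have "exp (\<psi> u) * deriv \<psi> u = 1"
      using DERIV_ident DERIV_unique by blast
    then have "deriv \<psi> u = 1 / exp (\<psi> u)"
      by (simp add: field_simps)
    moreover have "deriv (\<lambda>z. f (\<psi> z)) u = deriv f (\<psi> u) * deriv \<psi> u"
      using DERIV_chain2[OF 2 1] by (rule DERIV_imp_deriv)
    ultimately show ?thesis
      using surf_deriv_eq[OF 2] by simp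
  qed
  have "(surf_deriv ^^ Suc n) f (\<psi> z) = (deriv ^^ n) (\<lambda>z. surf_deriv f (\<psi> z)) z"
    unfolding funpow_Suc_right comp_def
    using surf_deriv_holomorphic[OF Suc.prems assms(2)] by (rule Suc.IH)
  also have "\<dots> = (deriv ^^ n) (deriv (\<lambda>z. f (\<psi> z))) z"
    using assms Suc.prems surf_deriv_holomorphic[OF Suc.prems assms(2)] hol[OF Suc.prems]
    by (intro higher_deriv_transform_within_open[where S = T] hol holomorphic_deriv der) auto
  finally show ?case
    unfolding funpow_Suc_right comp_def .
qed

lemma higher_deriv_polynomial:
  fixes c :: "nat \<Rightarrow> complex"
  shows "(deriv ^^ n) (\<lambda>z. \<Sum>p<Suc n. c p * z ^ p) = (\<lambda>_. fact n * c n)"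
proof (induction n arbitrary: c)
  case 0
  then show ?case by simp
next
  case (Suc n)
  have "deriv (\<lambda>z. \<Sum>p<Suc (Suc n). c p * z ^ p) =
    (\<lambda>z. \<Sum>p<Suc n. (of_nat (Suc p) * c (Suc p)) * z ^ p)"
  proof
    fix z :: complex
    have "((\<lambda>z. \<Sum>p<Suc (Suc n). c p * z ^ p) has_field_derivative
      (\<Sum>p<Suc (Suc n). c p * (of_nat p * z ^ (p - 1)))) (at z)"
      by (rule DERIV_sum) (auto intro!: derivative_eq_intros)
    then have "deriv (\<lambda>z. \<Sum>p<Suc (Suc n). c p * z ^ p) z
      = (\<Sum>p<Suc (Suc n). c p * (of_nat p * z ^ (p - 1)))"
      by (rule DERIV_imp_deriv)
    also have "\<dots> = (\<Sum>p<Suc n. (of_nat (Suc p) * c (Suc p)) * z ^ p)"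
      by (subst sum.lessThan_Suc_shift) (simp add: mult_ac)
    finally show "deriv (\<lambda>z. \<Sum>p<Suc (Suc n). c p * z ^ p) z
      = (\<Sum>p<Suc n. (of_nat (Suc p) * c (Suc p)) * z ^ p)" .
  qed
  then have "(deriv ^^ Suc n) (\<lambda>z. \<Sum>p<Suc (Suc n). c p * z ^ p)
    = (\<lambda>_. fact n * (of_nat (Suc n) * c (Suc n)))"
    unfolding funpow_Suc_right comp_def using Suc.IH by simp
  then show ?case
    by (simp only: fact_Suc mult_ac of_nat_mult of_nat_fact)
qed

section \<open>From remainder estimates to derivative estimates\<close>

text \<open>Cauchy's inequality for the remainder of order \<open>k\<close> in the disc of radius \<open>\<delta> |z|\<close> around
  \<open>z\<close>. For \<open>z\<close> in the smaller sector this disc lies in the larger one, because the logarithm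
  moves by less than \<open>4 \<delta>\<close> on the disc of twice the radius. The case \<open>k = n\<close> bounds the
  \<open>n\<close>-th derivative of the function, the case \<open>k = n + 1\<close> identifies its limit at \<open>0\<close>.\<close>

lemma surf_deriv_Cauchy:
  assumes F: "F holomorphic_on sector r"
    and \<delta>: "0 < \<delta>" "\<delta> \<le> 1/4" "4 * \<delta> \<le> (r - \<gamma>) * pi / 2"
    and rem: "\<And>w. w \<in> sector r \<Longrightarrow> cmod (F w - (\<Sum>p<k. c p * exp w ^ p)) \<le> B * cmod (exp w) ^ k"
    and w: "w \<in> sector \<gamma>"
    and k: "k \<le> Suc n"
  shows "cmod ((surf_deriv ^^ n) F w - (if k = Suc n then fact n * c n else 0))
    \<le> fact n * (B * (2 * cmod (exp w)) ^ k) / (\<delta> * cmod (exp w)) ^ n"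
proof -
  define z0 where "z0 = exp w"
  define \<psi> where "\<psi> z = w + Ln (z / z0)" for z
  define T where "T = ball z0 (2 * \<delta> * cmod z0)"
  have z0: "z0 \<noteq> 0" "cmod z0 > 0" by (auto simp: z0_def)
  have w_r: "w \<in> sector r"
  proof -
    have "0 \<le> (r - \<gamma>) * pi / 2" using \<delta> by linarith
    then have "\<gamma> * pi / 2 \<le> r * pi / 2" by (simp add: left_diff_distrib diff_divide_distrib)
    then show ?thesis using w unfolding sector_def mem_Collect_eq by linarith
  qed
  have near: "cmod (z / z0 - 1) < 2 * \<delta>" if "z \<in> T" for z
  proof -
    have "cmod (z / z0 - 1) = cmod (z - z0) / cmod z0"
      using z0 by (simp add: diff_divide_distrib flip: norm_divide)
    also have "\<dots> < 2 * \<delta>"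
      using that z0 by (simp add: T_def dist_norm norm_minus_commute field_simps)
    finally show ?thesis .
  qed
  have Re_pos: "Re (z / z0) > 0" if "z \<in> T" for z
  proof -
    have "\<bar>Re (z / z0 - 1)\<bar> < 2 * \<delta>"
      using near[OF that] abs_Re_le_cmod[of "z / z0 - 1"] by linarith
    then show ?thesis using \<delta> by simp
  qed
  have nonneg: "z / z0 \<notin> \<real>\<^sub>\<le>\<^sub>0" if "z \<in> T" for z
    using Re_pos[OF that] by (auto simp: complex_nonpos_Reals_iff)
  have hol\<psi>: "\<psi> holomorphic_on T"
    unfolding \<psi>_def using nonneg z0 by (auto intro!: holomorphic_intros)
  have inv: "exp (\<psi> z) = z" if "z \<in> T" for z
  proof -
    have "z / z0 \<noteq> 0" using Re_pos[OF that] by auto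
    then show ?thesis using z0 by (simp add: \<psi>_def exp_add flip: z0_def)
  qed
  have sub: "\<psi> ` T \<subseteq> sector r"
  proof
    fix v assume "v \<in> \<psi> ` T"
    then obtain z where z: "z \<in> T" "v = \<psi> z" by blast
    have n: "cmod (z / z0 - 1) < 2 * \<delta>" using near[OF z(1)] .
    have "cmod (Ln (1 + (z / z0 - 1))) \<le> 2 * cmod (z / z0 - 1)"
      using n \<delta> by (intro norm_Ln_le) auto
    then have "\<bar>Im (Ln (z / z0))\<bar> < 4 * \<delta>"
      using n abs_Im_le_cmod[of "Ln (z / z0)"] by simp
    then have "\<bar>Im v\<bar> < \<bar>Im w\<bar> + (r - \<gamma>) * pi / 2"
      using \<delta> unfolding z \<psi>_def by simp
    moreover have "\<bar>Im w\<bar> < \<gamma> * pi / 2" using w by (simp add: sector_def argument_def)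
    ultimately show "v \<in> sector r"
      by (simp add: sector_def argument_def left_diff_distrib diff_divide_distrib)
  qed
  have z0T: "z0 \<in> T" using z0 \<delta> by (simp add: T_def)
  have \<psi>z0: "\<psi> z0 = w" using z0 by (simp add: \<psi>_def)
  define pol where "pol z = (\<Sum>p<k. c p * z ^ p)" for z
  have holpol: "pol holomorphic_on A" for A
    unfolding pol_def by (intro holomorphic_intros)
  have holF: "(\<lambda>z. F (\<psi> z)) holomorphic_on T"
    using holomorphic_on_compose_gen[OF hol\<psi> F sub] by (simp add: o_def)
  have pol_deriv: "(deriv ^^ n) pol z0 = (if k = Suc n then fact n * c n else 0)"
  proof (cases "k = Suc n")
    case True
    have "pol = (\<lambda>z. \<Sum>p<Suc n. c p * z ^ p)" by (simp add: pol_def True fun_eq_iff)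
    then show ?thesis using higher_deriv_polynomial[of n c] True by simp
  next
    case False
    define c' where "c' p = (if p < k then c p else 0)" for p
    have "pol z = (\<Sum>p<Suc n. c' p * z ^ p)" for z
      unfolding pol_def c'_def using k False
      by (intro sum.mono_neutral_cong_left) auto
    then have "pol = (\<lambda>z. \<Sum>p<Suc n. c' p * z ^ p)" by blast
    then show ?thesis using higher_deriv_polynomial[of n c'] False k by (simp add: c'_def)
  qed
  have csub: "cball z0 (\<delta> * cmod z0) \<subseteq> T" "ball z0 (\<delta> * cmod z0) \<subseteq> T"
  proof -
    have "\<delta> * cmod z0 < 2 * \<delta> * cmod z0" using \<delta> z0 by simp
    then show "cball z0 (\<delta> * cmod z0) \<subseteq> T" "ball z0 (\<delta> * cmod z0) \<subseteq> T"
      unfolding T_def by auto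
  qed
  have diffhol: "(\<lambda>z. F (\<psi> z) - pol z) holomorphic_on T"
    by (intro holomorphic_intros holF holpol)
  have "B \<ge> 0"
  proof -
    have "0 \<le> B * cmod (exp w) ^ k"
      using rem[OF w_r] norm_ge_zero order_trans by blast
    moreover have "0 < cmod (exp w) ^ k" by (intro zero_less_power) simp
    ultimately show ?thesis by (meson not_le mult_neg_pos)
  qed
  have "cmod ((deriv ^^ n) (\<lambda>z. F (\<psi> z) - pol z) z0)
      \<le> fact n * (B * (2 * cmod z0) ^ k) / (\<delta> * cmod z0) ^ n"
  proof (rule Cauchy_inequality)
    show "0 < \<delta> * cmod z0" using \<delta> z0 by simp
    show "(\<lambda>z. F (\<psi> z) - pol z) holomorphic_on ball z0 (\<delta> * cmod z0)"
      using diffhol csub(2) by (rule holomorphic_on_subset)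
    show "continuous_on (cball z0 (\<delta> * cmod z0)) (\<lambda>z. F (\<psi> z) - pol z)"
      using diffhol csub(1) holomorphic_on_imp_continuous_on holomorphic_on_subset by blast
    fix x assume x: "cmod (z0 - x) = \<delta> * cmod z0"
    then have xT: "x \<in> T" using csub(1) by (auto simp: dist_norm)
    have "cmod (F (\<psi> x) - pol x) \<le> B * cmod x ^ k"
      using rem[of "\<psi> x"] sub xT inv[OF xT] by (auto simp: pol_def)
    also have "\<dots> \<le> B * (2 * cmod z0) ^ k"
    proof -
      have "cmod x \<le> cmod z0 + cmod (z0 - x)"
        using norm_triangle_ineq4[of z0 "z0 - x"] by simp
      also have "\<dots> \<le> 2 * cmod z0" unfolding x using \<delta> z0 mult_right_mono[of \<delta> 1 "cmod z0"] by simp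
      finally show ?thesis using \<open>B \<ge> 0\<close> by (intro mult_left_mono power_mono) auto
    qed
    finally show "cmod (F (\<psi> x) - pol x) \<le> B * (2 * cmod z0) ^ k" .
  qed
  moreover have "(deriv ^^ n) (\<lambda>z. F (\<psi> z) - pol z) z0
      = (surf_deriv ^^ n) F w - (if k = Suc n then fact n * c n else 0)"
  proof -
    have "(surf_deriv ^^ n) F (\<psi> z0) = (deriv ^^ n) (\<lambda>z. F (\<psi> z)) z0"
      using F open_sector _ hol\<psi> sub inv z0T by (rule surf_deriv_chart) (simp add: T_def)
    moreover have "(deriv ^^ n) (\<lambda>z. F (\<psi> z) - pol z) z0
      = (deriv ^^ n) (\<lambda>z. F (\<psi> z)) z0 - (deriv ^^ n) pol z0"
      using holF holpol _ z0T by (rule higher_deriv_diff) (simp add: T_def)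
    ultimately show ?thesis using pol_deriv \<psi>z0 by simp
  qed
  ultimately show ?thesis by (simp add: z0_def)
qed

lemma to_zero_in_sector_neq_bot:
  assumes "0 < \<gamma>"
  shows "to_zero_in (sector \<gamma>) \<noteq> bot"
proof -
  have "filterlim (\<lambda>x. complex_of_real (- real x)) (to_zero_in (sector \<gamma>)) sequentially"
    unfolding to_zero_in_def
  proof (intro filterlim_inf[THEN iffD2] conjI)
    have "((\<lambda>x. exp (- real x)) \<longlongrightarrow> 0) sequentially"
      by (rule filterlim_compose[OF exp_at_bot])
        (simp add: filterlim_uminus_at_bot filterlim_real_sequentially)
    then have "((\<lambda>x. proj (complex_of_real (- real x))) \<longlongrightarrow> 0) sequentially"
      unfolding proj_def using tendsto_of_real_iff[of "\<lambda>x. exp (- real x)" 0, where ?'a = complex]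
      by (simp add: exp_of_real flip: of_real_minus)
    then show "filterlim (\<lambda>x. complex_of_real (- real x)) (filtercomap proj (nhds 0)) sequentially"
      by (simp add: filterlim_filtercomap_iff o_def)
    show "filterlim (\<lambda>x. complex_of_real (- real x)) (principal (sector \<gamma>)) sequentially"
      using assms by (simp add: filterlim_principal sector_def argument_def)
  qed
  then show ?thesis
    by (metis filterlim_def le_bot filtermap_bot_iff trivial_limit_sequentially)
qed

lemma tendsto_to_zero_in:
  assumes "\<And>w. w \<in> S \<Longrightarrow> cmod (g w - l) \<le> K * cmod (exp w)"
  shows "(g \<longlongrightarrow> l) (to_zero_in S)"
proof -
  have "(proj \<longlongrightarrow> 0) (filtercomap proj (nhds 0))"
    by (rule filterlim_filtercomap)
  then have "(proj \<longlongrightarrow> 0) (to_zero_in S)"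
    unfolding to_zero_in_def by (rule filterlim_mono) auto
  then have "((\<lambda>w. K * cmod (exp w)) \<longlongrightarrow> 0) (to_zero_in S)"
    using tendsto_mult_right_zero tendsto_norm_zero unfolding proj_def by blast
  moreover have "\<forall>\<^sub>F w in to_zero_in S. cmod (g w - l) \<le> K * cmod (exp w)"
    unfolding to_zero_in_def eventually_inf_principal using assms by simp
  ultimately have "((\<lambda>w. g w - l) \<longlongrightarrow> 0) (to_zero_in S)"
    by (rule Lim_null_comparison[rotated])
  then show ?thesis by (rule LIM_zero_cancel)
qed

section \<open>Series of holomorphic functions and primitives on a strip\<close>

lemma holomorphic_suminf:
  fixes f :: "nat \<Rightarrow> complex \<Rightarrow> complex"
  assumes "open S" "\<And>n. f n holomorphic_on S" "summable M" "continuous_on S \<phi>"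
    and bound: "\<And>n x. x \<in> S \<Longrightarrow> cmod (f n x) \<le> M n * \<phi> x"
    and M: "\<And>n. 0 \<le> M n"
  shows "(\<lambda>x. \<Sum>n. f n x) holomorphic_on S"
proof (rule holomorphic_uniform_sequence[OF assms(1)])
  show "(\<lambda>x. \<Sum>i<n. f i x) holomorphic_on S" for n
    by (intro holomorphic_intros assms)
  fix x assume "x \<in> S"
  then obtain d where d: "0 < d" "cball x d \<subseteq> S"
    using assms(1) open_contains_cball by blast
  have "compact (\<phi> ` cball x d)"
    using assms(4) d(2) by (intro compact_continuous_image) (auto intro: continuous_on_subset)
  then obtain K where K: "\<And>y. y \<in> cball x d \<Longrightarrow> \<phi> y \<le> K"
    using compact_imp_bounded bounded_imp_bdd_above unfolding bdd_above_def by (metis imageI)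
  have "uniform_limit (cball x d) (\<lambda>n x. \<Sum>i<n. f i x) (\<lambda>x. \<Sum>n. f n x) sequentially"
  proof (rule Weierstrass_m_test)
    show "summable (\<lambda>n. M n * K)" using assms(3) by (rule summable_mult2)
    show "cmod (f n y) \<le> M n * K" if "y \<in> cball x d" for n y
      using bound[of y n] d that K[OF that] M[of n] by (meson mult_left_mono order_trans subsetD)
  qed
  then show "\<exists>d>0. cball x d \<subseteq> S \<and> uniform_limit (cball x d) (\<lambda>n x. \<Sum>i<n. f i x)
      (\<lambda>x. \<Sum>n. f n x) sequentially"
    using d by blast
qed

lemma dominated_increments_limit_at_top:
  fixes f :: "real \<Rightarrow> complex" and H :: "real \<Rightarrow> real"
  assumes incr: "\<And>x y. x \<le> y \<Longrightarrow> cmod (f y - f x) \<le> H y - H x"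
    and H: "(H \<longlongrightarrow> l) at_top"
  shows "\<exists>L. (f \<longlongrightarrow> L) at_top"
proof -
  have H': "(\<lambda>n. H (real n)) \<longlonglongrightarrow> l"
    using H filterlim_real_sequentially by (rule filterlim_compose)
  have le: "cmod (f x - f y) \<le> \<bar>H x - H y\<bar>" for x y
    using incr[of x y] incr[of y x] by (cases "x \<le> y") (auto simp: norm_minus_commute)
  have "Cauchy (\<lambda>n. f (real n))"
    unfolding Cauchy_def
  proof (intro allI impI)
    fix e :: real assume "e > 0"
    then obtain M where "\<And>m n. m \<ge> M \<Longrightarrow> n \<ge> M \<Longrightarrow> \<bar>H (real m) - H (real n)\<bar> < e"
      using LIMSEQ_imp_Cauchy[OF H'] unfolding Cauchy_def dist_norm real_norm_def by blast
    then show "\<exists>M. \<forall>m\<ge>M. \<forall>n\<ge>M. dist (f (real m)) (f (real n)) < e"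
      unfolding dist_norm using le le_less_trans by blast
  qed
  then obtain L where L: "(\<lambda>n. f (real n)) \<longlonglongrightarrow> L"
    using Cauchy_convergent_iff convergent_def by blast
  have lim_le: "cmod (f x - L) \<le> l - H x" for x
  proof (rule tendsto_le)
    show "(\<lambda>n. cmod (f (real n) - f x)) \<longlonglongrightarrow> cmod (f x - L)"
      using tendsto_norm[OF tendsto_diff[OF L tendsto_const[of "f x"]]]
      by (simp add: norm_minus_commute)
    show "(\<lambda>n. H (real n) - H x) \<longlonglongrightarrow> l - H x"
      by (intro tendsto_intros H')
    show "\<forall>\<^sub>F n in sequentially. cmod (f (real n) - f x) \<le> H (real n) - H x"
      using eventually_ge_at_top[of "nat \<lceil>x\<rceil>"]
      by eventually_elim (rule incr, linarith)
  qed simp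
  have "((\<lambda>x. l - H x) \<longlongrightarrow> 0) at_top"
    using tendsto_diff[OF tendsto_const[of l] H] by simp
  with always_eventually[OF allI[OF lim_le]] have "((\<lambda>x. f x - L) \<longlongrightarrow> 0) at_top"
    by (rule Lim_null_comparison)
  then show ?thesis using LIM_zero_cancel by blast
qed

lemma dominated_increments_limit_at_bot:
  fixes f :: "real \<Rightarrow> complex" and H :: "real \<Rightarrow> real"
  assumes incr: "\<And>x y. x \<le> y \<Longrightarrow> cmod (f y - f x) \<le> H y - H x"
    and H: "(H \<longlongrightarrow> l) at_bot"
  shows "\<exists>L. (f \<longlongrightarrow> L) at_bot"
proof -
  have "\<exists>L. ((\<lambda>x. f (- x)) \<longlongrightarrow> L) at_top"
  proof (rule dominated_increments_limit_at_top)
    show "cmod (f (- y) - f (- x)) \<le> - H (- y) - - H (- x)" if "x \<le> y" for x y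
      using incr[of "- y" "- x"] that by (simp add: norm_minus_commute)
    show "((\<lambda>x. - H (- x)) \<longlongrightarrow> - l) at_top"
      using H unfolding filterlim_at_bot_mirror by (rule tendsto_minus)
  qed
  then show ?thesis by (simp add: filterlim_at_bot_mirror)
qed

text \<open>The bounded increasing function \<open>2 arctan (e\<^sup>x)\<close>. Its derivative majorizes
  \<open>e\<^sup>x min 1 (e\<^sup>-\<^sup>2\<^sup>x)\<close>, the decay of the kernel times the Jacobian of \<open>t = e\<^sup>x\<close>, so that
  increments of primitives are controlled by increments of this function and no improper
  integral is needed.\<close>

definition atan_exp :: "real \<Rightarrow> real" where
  "atan_exp x = 2 * arctan (exp x)"

text \<open>The derivative of \<^const>\<open>atan_exp\<close>.\<close>

definition atan_exp' :: "real \<Rightarrow> real" where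
  "atan_exp' x = 2 * exp x / (1 + exp (2 * x))"

lemma atan_exp_deriv: "(atan_exp has_real_derivative atan_exp' x) (at x)"
  unfolding atan_exp_def atan_exp'_def
  by (rule derivative_eq_intros refl)+ (simp add: field_simps power2_eq_square flip: exp_add)

lemma atan_exp_bounds: "0 < atan_exp x" "atan_exp x < pi"
  using arctan_ubound[of "exp x"] by (auto simp: atan_exp_def)

lemma atan_exp_at_bot: "(atan_exp \<longlongrightarrow> 0) at_bot"
proof -
  have "((\<lambda>x. 2 * arctan (exp x)) \<longlongrightarrow> 2 * arctan (0::real)) at_bot"
    by (intro tendsto_intros exp_at_bot)
  then show ?thesis by (simp add: atan_exp_def[abs_def])
qed

lemma atan_exp_at_top: "(atan_exp \<longlongrightarrow> pi) at_top"
proof -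
  have "((\<lambda>x. 2 * arctan (exp x)) \<longlongrightarrow> 2 * (pi / 2)) at_top"
    by (intro tendsto_intros filterlim_compose[OF tendsto_arctan_at_top exp_at_top])
  then show ?thesis by (simp add: atan_exp_def[abs_def])
qed

lemma atan_exp'_nonneg: "0 \<le> atan_exp' x"
  by (simp add: atan_exp'_def add_nonneg_nonneg)

lemma min_exp_le_atan_exp': "exp x * min 1 (exp (- 2 * x)) \<le> atan_exp' x"
proof (cases "x \<le> 0")
  case True
  then have "exp (2 * x) \<le> 1" by simp
  then have "exp x * (1 + exp (2 * x)) \<le> exp x * 2" by (intro mult_left_mono) auto
  moreover have "exp x * min 1 (exp (- 2 * x)) \<le> exp x"
    by (simp add: mult_left_le)
  moreover have "exp x \<le> 2 * exp x / (1 + exp (2 * x))"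
    using calculation(1) by (simp add: pos_le_divide_eq add_pos_pos)
  ultimately show ?thesis by (simp add: atan_exp'_def)
next
  case False
  then have "1 \<le> exp (2 * x)" by simp
  have "exp x * min 1 (exp (- 2 * x)) \<le> exp x / exp (2 * x)"
    by (simp add: exp_minus divide_inverse)
  also have "\<dots> \<le> 2 * exp x / (1 + exp (2 * x))"
    using mult_left_mono[OF \<open>1 \<le> exp (2 * x)\<close>, of "exp x"]
    by (simp add: divide_simps add_pos_pos distrib_left)
  finally show ?thesis by (simp add: atan_exp'_def)
qed

text \<open>The horizontal line at height \<open>\<theta>\<close>, which is the ray of argument \<open>\<theta>\<close> on the surface.\<close>

definition hline :: "real \<Rightarrow> real \<Rightarrow> complex" where
  "hline \<theta> x = Complex x \<theta>"

lemma hline_deriv: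
  assumes "(P has_field_derivative D) (at (hline \<theta> x))"
  shows "((\<lambda>x. P (hline \<theta> x)) has_vector_derivative D) (at x)"
proof -
  have "((\<lambda>x. of_real x + \<i> * of_real \<theta>) has_vector_derivative 1 + 0) (at x)"
    by (intro has_vector_derivative_add has_vector_derivative_const)
      (use has_vector_derivative_of_real[OF DERIV_ident[of "at x"]] in simp)
  moreover have "(\<lambda>x. of_real x + \<i> * of_real \<theta>) = hline \<theta>"
    by (auto simp: hline_def complex_eq_iff)
  ultimately have "(hline \<theta> has_vector_derivative 1) (at x)" by simp
  from field_vector_diff_chain_at[OF this assms] show ?thesis by (simp add: o_def)
qed

lemma Re_hline [simp]: "Re (hline \<theta> x) = x" and Im_hline [simp]: "Im (hline \<theta> x) = \<theta>"
  by (simp_all add: hline_def)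

lemma hline_Re_Im: "hline (Im w) (Re w) = w"
  by (simp add: hline_def)

lemma increment_le_on_line:
  assumes "\<And>x. a < x \<Longrightarrow> x < b \<Longrightarrow> cmod (g (hline \<theta> x)) \<le> K * atan_exp' x"
    and "\<And>x. (P has_field_derivative g (hline \<theta> x)) (at (hline \<theta> x))" and "a \<le> b"
  shows "cmod (P (hline \<theta> b) - P (hline \<theta> a)) \<le> K * (atan_exp b - atan_exp a)"
proof (cases "a = b")
  case False
  have d: "((\<lambda>x. K * atan_exp x) has_vector_derivative K * atan_exp' x) (at x)" for x
    by (intro has_vector_derivative_mult_right
        atan_exp_deriv[unfolded has_real_derivative_iff_has_vector_derivative])
  have "cmod (P (hline \<theta> b) - P (hline \<theta> a)) \<le> K * atan_exp b - K * atan_exp a"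
  proof (rule differentiable_bound_general)
    show "a < b" using False assms(3) by simp
    show "continuous_on {a..b} (\<lambda>x. P (hline \<theta> x))"
      using hline_deriv[OF assms(2)]
      by (intro continuous_at_imp_continuous_on ballI) (rule has_vector_derivative_continuous)
    show "continuous_on {a..b} (\<lambda>x. K * atan_exp x)"
      using d by (intro continuous_at_imp_continuous_on ballI) (rule has_vector_derivative_continuous)
    show "((\<lambda>x. P (hline \<theta> x)) has_vector_derivative g (hline \<theta> x)) (at x)" for x
      by (rule hline_deriv[OF assms(2)])
  qed (use d assms in auto)
  then show ?thesis by (simp add: right_diff_distrib)
qed simp

text \<open>A function with integrable decay at both ends of the strip has a primitive with limits at
  both ends, each the same along all horizontal lines; the limit at the left end is normalized
  to \<open>0\<close>. This replaces the rotation of the path of integration in the moment integrals.\<close>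

lemma primitive_with_limits:
  assumes g: "g holomorphic_on sector r" and r: "0 < r"
    and bound: "\<And>w. w \<in> sector r \<Longrightarrow> cmod (g w) \<le> K * atan_exp' (Re w)"
  shows "\<exists>P m. (\<forall>w\<in>sector r. (P has_field_derivative g w) (at w)) \<and>
    (\<forall>\<theta>. hline \<theta> 0 \<in> sector r \<longrightarrow> ((\<lambda>x. P (hline \<theta> x)) \<longlongrightarrow> 0) at_bot \<and>
       ((\<lambda>x. P (hline \<theta> x)) \<longlongrightarrow> m) at_top)"
proof -
  obtain P where P: "\<And>w. w \<in> sector r \<Longrightarrow> (P has_field_derivative g w) (at w)"
    using holomorphic_convex_primitive'[OF convex_sector open_sector g]
    by (metis at_within_open open_sector)
  have line: "hline \<theta> x \<in> sector r" if "hline \<theta> 0 \<in> sector r" for \<theta> x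
    using that by (simp add: sector_def argument_def)
  have line0: "hline 0 x \<in> sector r" for x
    using r by (simp add: sector_def argument_def)
  have incr: "cmod (P (hline \<theta> y) - P (hline \<theta> x)) \<le> K * atan_exp y - K * atan_exp x"
    if "hline \<theta> 0 \<in> sector r" "x \<le> y" for \<theta> x y
    using increment_le_on_line[of x y g \<theta> K P] P bound line that
    by (fastforce simp: right_diff_distrib)
  have "\<exists>L. ((\<lambda>x. P (hline 0 x)) \<longlongrightarrow> L) at_top"
    by (rule dominated_increments_limit_at_top[OF incr[OF line0]])
      (auto intro!: tendsto_mult_left atan_exp_at_top)
  then obtain L where L: "((\<lambda>x. P (hline 0 x)) \<longlongrightarrow> L) at_top" ..
  have "\<exists>L. ((\<lambda>x. P (hline 0 x)) \<longlongrightarrow> L) at_bot"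
    by (rule dominated_increments_limit_at_bot[OF incr[OF line0]])
      (auto intro!: tendsto_mult_left atan_exp_at_bot)
  then obtain L0 where L0: "((\<lambda>x. P (hline 0 x)) \<longlongrightarrow> L0) at_bot" ..
  \<comment> \<open>Vertical segments have bounded length and the derivative tends to 0 at both ends.\<close>
  have across: "cmod (P (hline \<theta> x) - P (hline 0 x)) \<le> K * atan_exp' x * \<bar>\<theta>\<bar>"
    if "hline \<theta> 0 \<in> sector r" for \<theta> x
  proof -
    have "convex (sector r \<inter> {w. Re w = x})"
      by (intro convex_Int convex_sector) (simp add: convex_def flip: distrib_right)
    then have "cmod (P (hline \<theta> x) - P (hline 0 x)) \<le> K * atan_exp' x * cmod (hline \<theta> x - hline 0 x)"
      by (rule field_differentiable_bound[where f' = g])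
        (use P line[OF that] line0 bound in \<open>auto intro: has_field_derivative_at_within\<close>)
    also have "cmod (hline \<theta> x - hline 0 x) = \<bar>\<theta>\<bar>"
      by (simp add: cmod_def hline_def)
    finally show ?thesis .
  qed
  have lim': "(atan_exp' \<longlongrightarrow> 0) at_top" "(atan_exp' \<longlongrightarrow> 0) at_bot"
    unfolding atan_exp'_def by real_asymp+
  have move: "((\<lambda>x. P (hline \<theta> x)) \<longlongrightarrow> l) F"
    if "hline \<theta> 0 \<in> sector r" "(atan_exp' \<longlongrightarrow> 0) F" "((\<lambda>x. P (hline 0 x)) \<longlongrightarrow> l) F" for \<theta> l F
  proof -
    have "((\<lambda>x. K * atan_exp' x * \<bar>\<theta>\<bar>) \<longlongrightarrow> K * 0 * \<bar>\<theta>\<bar>) F"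
      by (intro tendsto_intros that)
    then have "((\<lambda>x. K * atan_exp' x * \<bar>\<theta>\<bar>) \<longlongrightarrow> 0) F" by simp
    with always_eventually[OF allI[OF across[OF that(1)]]]
    have "((\<lambda>x. P (hline \<theta> x) - P (hline 0 x)) \<longlongrightarrow> 0) F"
      by (rule Lim_null_comparison)
    from tendsto_add[OF this that(3)] show ?thesis by simp
  qed
  define Q where "Q w = P w - L0" for w
  have "\<forall>w\<in>sector r. (Q has_field_derivative g w) (at w)"
    unfolding Q_def using P by (auto intro!: derivative_eq_intros)
  moreover have "((\<lambda>x. Q (hline \<theta> x)) \<longlongrightarrow> 0) at_bot \<and> ((\<lambda>x. Q (hline \<theta> x)) \<longlongrightarrow> L - L0) at_top"
    if "hline \<theta> 0 \<in> sector r" for \<theta>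
    using tendsto_diff[OF move[OF that lim'(2) L0] tendsto_const[of L0]]
      tendsto_diff[OF move[OF that lim'(1) L] tendsto_const[of L0]]
    by (simp add: Q_def)
  ultimately show ?thesis by blast
qed

section \<open>The flat kernel\<close>

text \<open>In the variable \<open>z = e\<^sup>w\<close> the kernel is
  \<open>((1 + z\<^sup>1\<^sup>/\<^sup>r) \<Prod>k. (1 + (z / \<nu>\<^sub>k)\<^sup>1\<^sup>/\<^sup>r))\<^sup>-\<^sup>r\<close>, the product being over \<open>k \<ge> 0\<close>. It is written
  with logarithms, which are single-valued on the sector of opening \<open>r\<close> since
  \<open>z\<^sup>1\<^sup>/\<^sup>r\<close> has positive real part there. The factor with \<open>k = 0\<close>, for which
  \<open>\<nu>\<^sub>0 = 1\<close>, and the additional first factor provide the decay \<open>|z|\<^sup>-\<^sup>2\<close> that makes the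
  moments converge.\<close>

definition kernel :: "(nat \<Rightarrow> real) \<Rightarrow> real \<Rightarrow> complex \<Rightarrow> complex" where
  "kernel \<nu> r w = exp (- of_real r * (Ln (1 + exp (w / of_real r)) +
     (\<Sum>k. Ln (1 + of_real ((1 / \<nu> k) powr (1 / r)) * exp (w / of_real r)))))"

text \<open>The kernel on the real axis.\<close>

definition kernel_real :: "(nat \<Rightarrow> real) \<Rightarrow> real \<Rightarrow> real \<Rightarrow> real" where
  "kernel_real \<nu> r x = exp (- r * (ln (1 + exp (x / r)) +
     (\<Sum>k. ln (1 + (1 / \<nu> k) powr (1 / r) * exp (x / r)))))"

lemma Re_exp_div_pos:
  assumes "w \<in> sector r" "0 < r"
  shows "0 < Re (exp (w / of_real r))"
proof -
  have "\<bar>Im w / r\<bar> < pi / 2"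
    using assms by (simp add: sector_def argument_def abs_divide field_simps)
  then have "0 < cos (Im w / r)"
    by (intro cos_gt_zero_pi; linarith)
  then show ?thesis by (simp add: Re_exp)
qed

lemma norm_Ln_1_plus_le:
  assumes "0 \<le> Re z"
  shows "cmod (Ln (1 + z)) \<le> cmod z"
proof -
  have "cmod (Ln (1 + z) - Ln (1 + 0)) \<le> 1 * cmod (z - 0)"
  proof (rule field_differentiable_bound[of "{z. 0 \<le> Re z}" "\<lambda>z. Ln (1 + z)" "\<lambda>z. 1 / (1 + z)"])
    show "convex {z. 0 \<le> Re z}" by (rule convex_halfspace_Re_ge)
    fix u :: complex assume u: "u \<in> {z. 0 \<le> Re z}"
    then have "1 + u \<notin> \<real>\<^sub>\<le>\<^sub>0" by (auto simp: complex_nonpos_Reals_iff)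
    then show "((\<lambda>z. Ln (1 + z)) has_field_derivative 1 / (1 + u)) (at u within {z. 0 \<le> Re z})"
      by (auto intro!: derivative_eq_intros simp: divide_inverse)
    have "1 \<le> cmod (1 + u)"
      using u complex_Re_le_cmod[of "1 + u"] by simp
    then show "cmod (1 / (1 + u)) \<le> 1" by (simp add: norm_divide divide_simps)
  qed (use assms in auto)
  then show ?thesis by simp
qed

lemma ln_norm_1_plus_ge:
  assumes "0 < Re z"
  shows "0 \<le> ln (cmod (1 + z))" "ln (cmod z) \<le> ln (cmod (1 + z))"
proof -
  have 1: "1 \<le> cmod (1 + z)"
    using assms complex_Re_le_cmod[of "1 + z"] by simp
  then show "0 \<le> ln (cmod (1 + z))" by simp
  have "cmod z \<le> cmod (1 + z)"
    unfolding cmod_def using assms by (intro real_sqrt_le_mono) (simp add: power2_eq_square algebra_simps)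
  moreover have "0 < cmod z" using assms by auto
  ultimately show "ln (cmod z) \<le> ln (cmod (1 + z))" using 1 by (subst ln_le_cancel_iff) auto
qed

context
  fixes \<nu> :: "nat \<Rightarrow> real" and r :: real
  assumes r: "0 < r" and \<nu>: "\<And>k. 0 < \<nu> k"
    and summ: "summable (\<lambda>k. (1 / \<nu> k) powr (1 / r))"
begin

lemma kernel_factor_Re_pos:
  assumes "w \<in> sector r"
  shows "0 < Re (of_real ((1 / \<nu> k) powr (1 / r)) * exp (w / of_real r))"
  using Re_exp_div_pos[OF assms r] \<nu>[of k] by simp

lemma kernel_factor_le:
  assumes "w \<in> sector r"
  shows "cmod (Ln (1 + of_real ((1 / \<nu> k) powr (1 / r)) * exp (w / of_real r)))
    \<le> (1 / \<nu> k) powr (1 / r) * cmod (exp (w / of_real r))"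
  using norm_Ln_1_plus_le[of "of_real ((1 / \<nu> k) powr (1 / r)) * exp (w / of_real r)"]
    kernel_factor_Re_pos[OF assms, of k] by (simp add: norm_mult del: norm_exp_eq_Re)

lemma kernel_summable:
  assumes "w \<in> sector r"
  shows "summable (\<lambda>k. Ln (1 + of_real ((1 / \<nu> k) powr (1 / r)) * exp (w / of_real r)))"
  by (rule summable_comparison_test'[OF summable_mult2[OF summ] kernel_factor_le[OF assms]])

lemma kernel_holomorphic: "kernel \<nu> r holomorphic_on sector r"
proof -
  have 1: "1 + of_real b * exp (w / of_real r) \<notin> \<real>\<^sub>\<le>\<^sub>0" if "w \<in> sector r" "0 \<le> b" for w b
    using mult_nonneg_nonneg[OF that(2) less_imp_le[OF Re_exp_div_pos[OF that(1) r]]]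
    by (auto simp: complex_nonpos_Reals_iff)
  have "(\<lambda>w. \<Sum>k. Ln (1 + of_real ((1 / \<nu> k) powr (1 / r)) * exp (w / of_real r)))
      holomorphic_on sector r"
    using open_sector _ summ _ kernel_factor_le
  proof (rule holomorphic_suminf)
    show "(\<lambda>w. Ln (1 + of_real ((1 / \<nu> n) powr (1 / r)) * exp (w / of_real r)))
        holomorphic_on sector r" for n
      using 1 r by (auto intro!: holomorphic_intros)
    show "continuous_on (sector r) (\<lambda>w. cmod (exp (w / of_real r)))"
      using r by (intro continuous_intros) auto
  qed auto
  moreover have "(\<lambda>w. Ln (1 + exp (w / of_real r))) holomorphic_on sector r"
    using 1[of _ 1] r by (auto intro!: holomorphic_intros)
  ultimately show ?thesis
    unfolding kernel_def[abs_def]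
    by (intro holomorphic_on_exp' holomorphic_on_mult holomorphic_on_const holomorphic_on_add)
qed

text \<open>The kernel is flat at infinity. Before the power \<open>-r\<close> is taken, every factor of the product has
  modulus at least \<open>1\<close> and at least \<open>(|z| / \<nu>\<^sub>k)\<^sup>1\<^sup>/\<^sup>r\<close>. The second bound is used for
  \<open>1 \<le> k \<le> n\<close>, the first for \<open>k > n\<close>, and the better of the two for \<open>k = 0\<close> and for the
  additional factor.\<close>

lemma norm_kernel_le:
  assumes w: "w \<in> sector r" and \<nu>0: "\<nu> 0 = 1"
  shows "cmod (kernel \<nu> r w) \<le>
    (\<Prod>k=1..n. \<nu> k) * exp (- real n * Re w) * min 1 (exp (- 2 * Re w))"
proof -
  define z where "z k = of_real ((1 / \<nu> k) powr (1 / r)) * exp (w / of_real r)" for k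
  have z: "0 < Re (z k)" for k unfolding z_def by (rule kernel_factor_Re_pos[OF w])
  have ln_z: "ln (cmod (z k)) = (Re w - ln (\<nu> k)) / r" for k
    using \<nu>[of k] r unfolding z_def by (simp add: norm_mult ln_mult ln_div ln_powr field_simps)
  have Re_Ln: "Re (Ln (1 + z k)) = ln (cmod (1 + z k))" for k
  proof -
    have "Re (1 + z k) \<noteq> 0" using z[of k] by simp
    then have "1 + z k \<noteq> 0" by (metis zero_complex.simps(1))
    then show ?thesis by (rule Re_Ln)
  qed
  have z0: "z 0 = exp (w / of_real r)" by (simp add: z_def \<nu>0)
  have sm: "summable (\<lambda>k. Ln (1 + z k))"
    unfolding z_def by (rule kernel_summable[OF w])
  have zero: "max 0 (Re w) \<le> r * ln (cmod (1 + z 0))"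
    using ln_norm_1_plus_ge[OF z[of 0]] r ln_z[of 0] \<nu>0 by (auto simp: field_simps)
  have "(\<Sum>k<Suc n. ln (cmod (1 + z k))) \<le> (\<Sum>k. ln (cmod (1 + z k)))"
    using ln_norm_1_plus_ge(1)[OF z] bounded_linear.summable[OF bounded_linear_Re sm]
    by (intro sum_le_suminf) (auto simp: Re_Ln)
  also have "\<dots> = Re (\<Sum>k. Ln (1 + z k))"
    using bounded_linear.suminf[OF bounded_linear_Re sm] by (simp add: Re_Ln)
  finally have tail: "r * (\<Sum>k<Suc n. ln (cmod (1 + z k))) \<le> r * Re (\<Sum>k. Ln (1 + z k))"
    using r by simp
  have "(\<Sum>k=1..n. Re w - ln (\<nu> k)) \<le> (\<Sum>k=1..n. r * ln (cmod (1 + z k)))"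
    using ln_norm_1_plus_ge(2)[OF z] ln_z r by (intro sum_mono) (simp add: field_simps)
  also have "max 0 (Re w) + \<dots> \<le> r * ln (cmod (1 + z 0)) + (\<Sum>k=1..n. r * ln (cmod (1 + z k)))"
    using zero by simp
  also have "\<dots> = (\<Sum>k<Suc n. r * ln (cmod (1 + z k)))"
    unfolding lessThan_Suc_atMost atMost_atLeast0
    by (subst (2) sum.atLeast_Suc_atMost) auto
  also have "\<dots> \<le> r * Re (\<Sum>k. Ln (1 + z k))"
    using tail by (simp only: sum_distrib_left)
  finally have "max 0 (Re w) + (\<Sum>k=1..n. Re w - ln (\<nu> k)) \<le> r * Re (\<Sum>k. Ln (1 + z k))"
    by simp
  moreover have "(\<Sum>k=1..n. Re w - ln (\<nu> k)) = real n * Re w - (\<Sum>k=1..n. ln (\<nu> k))"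
    by (simp add: sum_subtractf)
  ultimately have "max 0 (Re w) + max 0 (Re w) + real n * Re w - (\<Sum>k=1..n. ln (\<nu> k))
      \<le> r * Re (Ln (1 + z 0)) + r * Re (\<Sum>k. Ln (1 + z k))"
    using zero unfolding Re_Ln by linarith
  moreover have "cmod (kernel \<nu> r w) = exp (- (r * Re (Ln (1 + z 0)) + r * Re (\<Sum>k. Ln (1 + z k))))"
    unfolding kernel_def by (simp add: z0 flip: z_def) (simp add: distrib_left)
  ultimately have "cmod (kernel \<nu> r w)
      \<le> exp ((\<Sum>k=1..n. ln (\<nu> k)) + (- real n * Re w) + (- 2 * max 0 (Re w)))"
    by simp
  also have "\<dots> = exp (\<Sum>k=1..n. ln (\<nu> k)) * exp (- real n * Re w) * exp (- 2 * max 0 (Re w))"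
    by (simp only: exp_add)
  also have "exp (\<Sum>k=1..n. ln (\<nu> k)) = (\<Prod>k=1..n. \<nu> k)"
    using \<nu> by (simp add: exp_sum)
  also have "exp (- 2 * max 0 (Re w)) = min 1 (exp (- 2 * Re w))"
    by (simp add: max_def min_def)
  finally show ?thesis .
qed

lemma kernel_of_real: "kernel \<nu> r (of_real x) = of_real (kernel_real \<nu> r x)"
proof -
  have Ln: "Ln (1 + of_real b * exp (of_real x / of_real r)) = of_real (ln (1 + b * exp (x / r)))"
    if "0 \<le> b" for b :: real
  proof -
    have "0 < 1 + b * exp (x / r)" using that by (simp add: add_pos_nonneg)
    then have "Ln (of_real (1 + b * exp (x / r))) = of_real (ln (1 + b * exp (x / r)))"
      by (rule Ln_of_real)
    then show ?thesis by (simp flip: exp_of_real)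
  qed
  have 0: "of_real x \<in> sector r"
    using r by (simp add: sector_def argument_def)
  have "(\<Sum>k. Ln (1 + of_real ((1 / \<nu> k) powr (1 / r)) * exp (of_real x / of_real r)))
      = (\<Sum>k. of_real (ln (1 + (1 / \<nu> k) powr (1 / r) * exp (x / r))))"
    by (subst Ln) auto
  also have "\<dots> = of_real (\<Sum>k. ln (1 + (1 / \<nu> k) powr (1 / r) * exp (x / r)))"
  proof (rule suminf_of_real[symmetric])
    have "summable (\<lambda>k. Re (Ln (1 + of_real ((1 / \<nu> k) powr (1 / r)) * exp (of_real x / of_real r))))"
      by (rule bounded_linear.summable[OF bounded_linear_Re kernel_summable[OF 0]])
    then show "summable (\<lambda>k. ln (1 + (1 / \<nu> k) powr (1 / r) * exp (x / r)))"
      by (subst (asm) Ln) auto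
  qed
  finally show ?thesis
    unfolding kernel_def kernel_real_def using Ln[of 1] by (simp flip: exp_of_real)
qed

lemma kernel_real_summable: "summable (\<lambda>k. ln (1 + (1 / \<nu> k) powr (1 / r) * exp (x / r)))"
proof (rule summable_comparison_test'[OF summable_mult2[OF summ]])
  show "norm (ln (1 + (1 / \<nu> n) powr (1 / r) * exp (x / r))) \<le> (1 / \<nu> n) powr (1 / r) * exp (x / r)"
    for n
    by (simp add: ln_add_one_self_le_self)
qed

lemma kernel_real_antimono:
  assumes "x \<le> y"
  shows "kernel_real \<nu> r y \<le> kernel_real \<nu> r x"
proof -
  have e: "exp (x / r) \<le> exp (y / r)" using assms r by (simp add: divide_right_mono)
  have "ln (1 + exp (x / r)) \<le> ln (1 + exp (y / r))"
    using e by (simp add: add_pos_pos)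
  moreover have "(\<Sum>k. ln (1 + (1 / \<nu> k) powr (1 / r) * exp (x / r)))
      \<le> (\<Sum>k. ln (1 + (1 / \<nu> k) powr (1 / r) * exp (y / r)))"
  proof (rule suminf_le[OF _ kernel_real_summable kernel_real_summable])
    fix k
    show "ln (1 + (1 / \<nu> k) powr (1 / r) * exp (x / r))
        \<le> ln (1 + (1 / \<nu> k) powr (1 / r) * exp (y / r))"
      using e mult_left_mono[OF e, of "(1 / \<nu> k) powr (1 / r)"] by (simp add: add_pos_nonneg)
  qed
  ultimately show ?thesis
    unfolding kernel_real_def using r by (simp add: mult_left_mono add_mono)
qed

end

lemma kernel_real_pos: "0 < kernel_real \<nu> r x"
  by (simp add: kernel_real_def)

section \<open>Incomplete moments\<close>

text \<open>With \<open>t = e\<^sup>w\<close>, the function \<open>P\<close> is the incomplete moment \<open>\<integral> t\<^sup>p G\<close> from \<open>0\<close> to \<open>e\<^sup>w\<close> and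
  \<open>m\<close> is the complete moment. The bounds with \<open>N\<^sub>n\<close> for arbitrary \<open>n\<close> estimate the lower part
  of the integral when \<open>n \<le> p\<close> and the upper part when \<open>p < n\<close>. In both cases \<open>t\<^sup>p\<^sup>-\<^sup>n\<close> is
  at most its value at the endpoint.\<close>

lemma incomplete_moments:
  fixes G :: "complex \<Rightarrow> complex" and N :: "nat \<Rightarrow> real" and \<kappa> :: "real \<Rightarrow> real"
  assumes r: "0 < r" and G: "G holomorphic_on sector r" and N: "\<And>n. 0 \<le> N n"
    and bound: "\<And>w n. w \<in> sector r \<Longrightarrow>
      cmod (G w) \<le> N n * exp (- real n * Re w) * min 1 (exp (- 2 * Re w))"
    and \<kappa>: "\<And>x. G (of_real x) = of_real (\<kappa> x)" "\<And>x. 0 \<le> \<kappa> x" "\<And>x y. x \<le> y \<Longrightarrow> \<kappa> y \<le> \<kappa> x"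
  shows "\<exists>P m. P holomorphic_on sector r \<and>
    (\<forall>w\<in>sector r. \<forall>n\<le>p. cmod (P w) \<le> pi * N n * exp ((real p - real n) * Re w)) \<and>
    (\<forall>w\<in>sector r. \<forall>n>p. cmod (m - P w) \<le> pi * N n * exp ((real p - real n) * Re w)) \<and>
    (\<forall>x. \<kappa> x * exp (real (Suc p) * x) / real (Suc p) \<le> Re m)"
proof -
  define g where "g w = exp (of_nat (Suc p) * w) * G w" for w
  have g_le: "cmod (g w) \<le> N n * exp ((real p - real n) * Re w) * atan_exp' (Re w)"
    if "w \<in> sector r" for w n
  proof -
    have "cmod (g w) \<le> exp (real (Suc p) * Re w) *
        (N n * exp (- real n * Re w) * min 1 (exp (- 2 * Re w)))"
      using bound[OF that, of n] by (simp add: g_def norm_mult mult_left_mono)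
    also have "\<dots> = N n * (exp ((real p - real n) * Re w)) * (exp (Re w) * min 1 (exp (- 2 * Re w)))"
    proof -
      have "real (Suc p) * Re w + - real n * Re w = (real p - real n) * Re w + Re w"
        by (simp add: algebra_simps)
      then have "exp (real (Suc p) * Re w) * exp (- real n * Re w)
          = exp ((real p - real n) * Re w) * exp (Re w)"
        by (metis exp_add)
      then show ?thesis by (simp add: mult_ac)
    qed
    also have "\<dots> \<le> N n * (exp ((real p - real n) * Re w)) * atan_exp' (Re w)"
      using N by (intro mult_left_mono min_exp_le_atan_exp') auto
    finally show ?thesis .
  qed
  have "g holomorphic_on sector r"
    unfolding g_def using G by (intro holomorphic_intros)
  moreover have "cmod (g w) \<le> N p * atan_exp' (Re w)" if "w \<in> sector r" for w
    using g_le[OF that, of p] by simp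
  ultimately obtain P m
    where P: "\<And>w. w \<in> sector r \<Longrightarrow> (P has_field_derivative g w) (at w)"
      and bot: "\<And>\<theta>. hline \<theta> 0 \<in> sector r \<Longrightarrow> ((\<lambda>x. P (hline \<theta> x)) \<longlongrightarrow> 0) at_bot"
      and top: "\<And>\<theta>. hline \<theta> 0 \<in> sector r \<Longrightarrow> ((\<lambda>x. P (hline \<theta> x)) \<longlongrightarrow> m) at_top"
    using primitive_with_limits[OF _ r] by blast
  have line: "hline (Im w) x \<in> sector r" if "w \<in> sector r" for w x
    using that by (simp add: sector_def argument_def)
  have incr: "cmod (P (hline (Im w) y) - P (hline (Im w) x)) \<le> pi * N n * exp ((real p - real n) * a)"
    if w: "w \<in> sector r" and xy: "x \<le> y"
      and mono: "\<And>s. x < s \<Longrightarrow> s < y \<Longrightarrow> (real p - real n) * s \<le> (real p - real n) * a" for w n x y a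
  proof -
    have "cmod (P (hline (Im w) y) - P (hline (Im w) x))
        \<le> (N n * exp ((real p - real n) * a)) * (atan_exp y - atan_exp x)"
    proof (rule increment_le_on_line[OF _ P[OF line[OF w]] xy])
      fix s assume s: "x < s" "s < y"
      have "cmod (g (hline (Im w) s)) \<le> N n * exp ((real p - real n) * s) * atan_exp' s"
        using g_le[OF line[OF w], of s n] by simp
      also have "\<dots> \<le> N n * exp ((real p - real n) * a) * atan_exp' s"
        using mono[OF s] N atan_exp'_nonneg by (intro mult_right_mono mult_left_mono) auto
      finally show "cmod (g (hline (Im w) s)) \<le> N n * exp ((real p - real n) * a) * atan_exp' s" .
    qed
    also have "\<dots> \<le> (N n * exp ((real p - real n) * a)) * pi"
      using atan_exp_bounds(1)[of x] atan_exp_bounds(2)[of y] N[of n] by (intro mult_left_mono) auto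
    finally show ?thesis by (simp add: mult_ac)
  qed
  have "P holomorphic_on sector r"
    using P open_sector by (metis field_differentiable_def field_differentiable_at_within holomorphic_on_def)
  moreover have "cmod (P w) \<le> pi * N n * exp ((real p - real n) * Re w)"
    if w: "w \<in> sector r" and n: "n \<le> p" for w n
  proof (rule tendsto_upperbound)
    show "((\<lambda>x. cmod (P w - P (hline (Im w) x))) \<longlongrightarrow> cmod (P w)) at_bot"
      using tendsto_norm[OF tendsto_diff[OF tendsto_const[of "P w"] bot[OF line[OF w]]]] by simp
    show "\<forall>\<^sub>F x in at_bot. cmod (P w - P (hline (Im w) x)) \<le> pi * N n * exp ((real p - real n) * Re w)"
      using eventually_le_at_bot[of "Re w"]
    proof eventually_elim
      fix x assume "x \<le> Re w"
      from incr[OF w this, of n "Re w"] n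
      show "cmod (P w - P (hline (Im w) x)) \<le> pi * N n * exp ((real p - real n) * Re w)"
        by (simp add: hline_Re_Im mult_left_mono)
    qed
  qed simp
  moreover have "cmod (m - P w) \<le> pi * N n * exp ((real p - real n) * Re w)"
    if w: "w \<in> sector r" and n: "p < n" for w n
  proof (rule tendsto_upperbound)
    show "((\<lambda>x. cmod (P (hline (Im w) x) - P w)) \<longlongrightarrow> cmod (m - P w)) at_top"
      by (intro tendsto_intros top[OF line[OF w]])
    show "\<forall>\<^sub>F x in at_top. cmod (P (hline (Im w) x) - P w) \<le> pi * N n * exp ((real p - real n) * Re w)"
      using eventually_ge_at_top[of "Re w"]
    proof eventually_elim
      fix x assume "Re w \<le> x"
      from incr[OF w this, of n "Re w"] n
      show "cmod (P (hline (Im w) x) - P w) \<le> pi * N n * exp ((real p - real n) * Re w)"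
        by (simp add: hline_Re_Im mult_left_mono_neg)
    qed
  qed simp
  moreover have "\<kappa> x * exp (real (Suc p) * x) / real (Suc p) \<le> Re m" for x
  proof -
    have in0: "hline 0 s \<in> sector r" for s
      using r by (simp add: sector_def argument_def)
    define Q where "Q s = Re (P (hline 0 s))" for s
    have Q: "(Q has_real_derivative exp (real (Suc p) * s) * \<kappa> s) (at s)" for s
    proof -
      have "hline 0 s = of_real s" by (simp add: hline_def complex_of_real_def)
      then have "g (hline 0 s) = of_real (exp (real (Suc p) * s) * \<kappa> s)"
        using \<kappa>(1)[of s] unfolding g_def
        by (simp only: of_real_mult of_real_of_nat_eq flip: exp_of_real)
      moreover have "(Q has_vector_derivative Re (g (hline 0 s))) (at s)"
        unfolding Q_def
        by (rule bounded_linear.has_vector_derivative[OF bounded_linear_Re hline_deriv[OF P[OF in0]]])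
      ultimately show ?thesis
        by (simp only: Re_complex_of_real has_real_derivative_iff_has_vector_derivative)
    qed
    have Qbot: "(Q \<longlongrightarrow> 0) at_bot" and Qtop: "(Q \<longlongrightarrow> Re m) at_top"
      unfolding Q_def using tendsto_Re[OF bot[OF in0]] tendsto_Re[OF top[OF in0]] by auto
    define q where "q = real (Suc p)"
    have q: "0 < q" by (simp add: q_def)
    define R where "R s = \<kappa> x * exp (q * s) / q" for s
    have R: "(R has_real_derivative exp (q * s) * \<kappa> x) (at s)" for s
      unfolding R_def using q by (auto intro!: derivative_eq_intros simp: field_simps)
    have RQ: "R x - R y \<le> Q x - Q y" if "y \<le> x" for y
    proof -
      have "(\<lambda>s. Q s - R s) y \<le> (\<lambda>s. Q s - R s) x"
      proof (rule DERIV_nonneg_imp_nondecreasing[OF that])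
        fix s assume "y \<le> s" "s \<le> x"
        then show "\<exists>d. ((\<lambda>s. Q s - R s) has_real_derivative d) (at s) \<and> 0 \<le> d"
          using \<kappa>(3)[of s x] DERIV_diff[OF Q R, of s]
          by (intro exI conjI) (auto simp: mult_left_mono q_def)
      qed
      then show ?thesis by simp
    qed
    have ev: "\<forall>\<^sub>F y in at_bot. R x - R y \<le> Q x - Q y"
      using eventually_le_at_bot[of x] by eventually_elim (rule RQ)
    have Rbot: "(R \<longlongrightarrow> 0) at_bot"
      unfolding R_def using q by real_asymp
    have "R x - 0 \<le> Q x - 0"
      by (rule tendsto_le[OF _ tendsto_diff[OF tendsto_const Qbot] tendsto_diff[OF tendsto_const Rbot] ev]) simp
    moreover have "Q x \<le> Re m"
    proof (rule tendsto_lowerbound[OF Qtop])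
      show "\<forall>\<^sub>F s in at_top. Q x \<le> Q s"
        using eventually_ge_at_top[of x]
      proof eventually_elim
        fix s assume "x \<le> s"
        then show "Q x \<le> Q s"
          by (rule DERIV_nonneg_imp_nondecreasing) (use Q \<kappa>(2) in \<open>force intro!: mult_nonneg_nonneg\<close>)
      qed
    qed simp
    ultimately show ?thesis by (simp add: R_def q_def)
  qed
  ultimately show ?thesis by blast
qed

section \<open>Weight sequences\<close>

lemma LC_D:
  assumes "M \<in> LC"
  shows LC_pos: "0 < M k" and LC_0: "M 0 = 1" and LC_1: "1 \<le> M 1"
    and LC_log_convex: "1 \<le> j \<Longrightarrow> (M j)\<^sup>2 \<le> M (j - 1) * M (j + 1)"
  using assms by (auto simp: LC_def)

lemma quot_pos: "M \<in> LC \<Longrightarrow> 0 < quot M k"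
  by (simp add: quot_def LC_pos)

lemma quot_0 [simp]: "quot M 0 = 1"
  by (simp add: quot_def)

lemma prod_quot:
  assumes "M \<in> LC"
  shows "(\<Prod>k=1..n. quot M k) = M n"
proof (induction n)
  case (Suc n)
  then show ?case using LC_pos[OF assms, of n] by (simp add: quot_def)
qed (simp add: LC_0[OF assms])

lemma quot_mono:
  assumes M: "M \<in> LC" and "j \<le> k"
  shows "quot M j \<le> quot M k"
proof (rule lift_Suc_mono_le[OF _ \<open>j \<le> k\<close>])
  fix n
  show "quot M n \<le> quot M (Suc n)"
  proof (cases n)
    case 0
    then show ?thesis using LC_0[OF M] LC_1[OF M] by (simp add: quot_def)
  next
    case (Suc i)
    then have "(M n)\<^sup>2 \<le> M i * M (Suc n)" using LC_log_convex[OF M, of n] by simp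
    then show ?thesis
      using Suc LC_pos[OF M] by (simp add: quot_def divide_simps power2_eq_square mult_ac)
  qed
qed

lemma quot_ge_1: "M \<in> LC \<Longrightarrow> 1 \<le> quot M k"
  using quot_mono[of M 0 k] by simp

text \<open>Of moderate growth only the case \<open>k = 1\<close> is used: the quotients grow at most
  geometrically.\<close>

lemma quot_geometric_bound:
  assumes M: "M \<in> LC" and "moderate_growth M"
  obtains B where "1 \<le> B" "\<And>n. quot M n \<le> M 1 * B ^ n"
proof -
  obtain B where B: "1 \<le> B" "\<And>j k. M (j + k) \<le> B ^ (j + k) * M j * M k"
    using assms(2) unfolding moderate_growth_def by blast
  have "quot M n \<le> M 1 * B ^ n" for n
  proof (cases n)
    case 0
    then show ?thesis using LC_1[OF M] by simp
  next
    case (Suc i)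
    then show ?thesis using B(2)[of i 1] LC_pos[OF M, of i]
      by (simp add: quot_def pos_divide_le_eq mult_ac)
  qed
  then show ?thesis using that B(1) by blast
qed

text \<open>One factor of the kernel at \<open>x = \<mu>\<^sub>n\<close>, to be used with \<open>y = \<mu>\<^sub>k\<close> and \<open>\<nu> = \<nu>\<^sub>k\<close>
  for \<open>k \<le> n\<close>.\<close>

lemma ln_1_plus_quotient_le:
  assumes "1 \<le> (x::real)" "0 < y" "y \<le> x" "1 \<le> C" "0 < r" "0 < \<nu>" "y \<le> C * \<nu>"
  shows "ln (1 + (1 / \<nu>) powr (1 / r) * exp (ln x / r))
    \<le> ln (1 + C powr (1 / r)) + (ln x - ln y) / r"
proof -
  have x: "exp (ln x / r) = x powr (1 / r)"
    using assms by (simp add: powr_def)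
  have "x / \<nu> \<le> C * (x / y)"
    using assms mult_left_mono[OF assms(7), of x] by (simp add: divide_simps mult_ac)
  have "(1 / \<nu>) powr (1 / r) * x powr (1 / r) = (x / \<nu>) powr (1 / r)"
    using assms by (simp flip: powr_mult)
  also have "\<dots> \<le> (C * (x / y)) powr (1 / r)"
    using assms \<open>x / \<nu> \<le> C * (x / y)\<close> by (intro powr_mono2) auto
  also have "\<dots> = C powr (1 / r) * (x / y) powr (1 / r)"
    by (rule powr_mult)
  finally have "(1 / \<nu>) powr (1 / r) * x powr (1 / r) \<le> C powr (1 / r) * (x / y) powr (1 / r)" .
  moreover have "1 \<le> (x / y) powr (1 / r)"
    using assms by (intro ge_one_powr_ge_zero) auto
  ultimately have "1 + (1 / \<nu>) powr (1 / r) * x powr (1 / r)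
      \<le> (1 + C powr (1 / r)) * (x / y) powr (1 / r)"
    by (simp add: distrib_right)
  then have "ln (1 + (1 / \<nu>) powr (1 / r) * x powr (1 / r))
      \<le> ln ((1 + C powr (1 / r)) * (x / y) powr (1 / r))"
    using assms by (intro ln_mono) (auto simp: add_pos_nonneg)
  also have "\<dots> = ln (1 + C powr (1 / r)) + (ln x - ln y) / r"
    using assms by (simp add: ln_mult ln_powr ln_div add_pos_nonneg add_nonneg_eq_0_iff)
  finally show ?thesis unfolding x .
qed

text \<open>At the point \<open>\<mu>\<^sub>n\<close> the kernel is as large as \<open>M\<^sub>n / \<mu>\<^sub>n\<^sup>n\<^sup>+\<^sup>2\<close>, up to a geometric factor. The
  factors with \<open>k \<le> n\<close> are compared with \<open>\<mu>\<^sub>n / \<mu>\<^sub>k\<close>. In the factors with \<open>k > n\<close>,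
  \<open>ln (1 + x) \<le> x\<close> leaves the tail of the series, which the growth condition at \<open>p = n\<close> bounds
  by a multiple of \<open>n\<close>.\<close>

lemma kernel_real_lower_bound:
  assumes M: "M \<in> LC" and N: "N \<in> LC" and C: "1 \<le> C" "\<And>p. quot M p \<le> C * quot N p"
    and r: "0 < r" and cond: "gamma_cond M N r"
  obtains D E where
    "\<And>n. exp (- (D * real n + E)) * M n / quot M n ^ (n + 2) \<le> kernel_real (quot N) r (ln (quot M n))"
proof -
  define b where "b k = (1 / quot N k) powr (1 / r)" for k
  have summ: "summable b" using cond by (simp add: gamma_cond_def b_def[abs_def])
  have b_nonneg: "0 \<le> b k" for k by (simp add: b_def)
  obtain B where B: "\<And>p. 1 \<le> p \<Longrightarrow> quot M p powr (1 / r) / real p * (\<Sum>k. b (p + k)) \<le> B"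
    using cond by (auto simp: gamma_cond_def bdd_above_def b_def)
  define S where "S = (\<Sum>k. b k)"
  define l where "l = ln (1 + C powr (1 / r))"
  have tail: "quot M n powr (1 / r) * (\<Sum>k. b (k + Suc n)) \<le> B * real n + S" for n
  proof (cases "n = 0")
    case True
    have "(\<Sum>k. b (Suc k)) \<le> S"
      using suminf_split_head[OF summ] b_nonneg[of 0] by (simp add: S_def)
    then show ?thesis using True by simp
  next
    case False
    have sn: "summable (\<lambda>k. b (k + n))" using summ by (rule summable_ignore_initial_segment)
    have "(\<Sum>k. b (k + Suc n)) \<le> (\<Sum>k. b (n + k))"
      using suminf_split_head[OF sn] b_nonneg[of n] by (simp add: add.commute)
    then have "quot M n powr (1 / r) * (\<Sum>k. b (k + Suc n)) \<le> quot M n powr (1 / r) * (\<Sum>k. b (n + k))"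
      by (intro mult_left_mono) auto
    also have "\<dots> \<le> B * real n"
      using B[of n] False by (simp add: divide_simps)
    also have "\<dots> \<le> B * real n + S"
      unfolding S_def using summ b_nonneg by (simp add: suminf_nonneg)
    finally show ?thesis .
  qed
  have main: "exp (- ((r * B + r * l) * real n + (r * S + 2 * r * l))) * M n / quot M n ^ (n + 2)
      \<le> kernel_real (quot N) r (ln (quot M n))" for n
  proof -
    define \<mu> where "\<mu> = quot M n"
    have \<mu>: "1 \<le> \<mu>" using quot_ge_1[OF M] by (simp add: \<mu>_def)
    define f where "f k = ln (1 + b k * exp (ln \<mu> / r))" for k
    have f_le: "f k \<le> b k * \<mu> powr (1 / r)" for k
      using ln_add_one_self_le_self[of "b k * \<mu> powr (1 / r)"] b_nonneg[of k] \<mu>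
      by (simp add: f_def powr_def)
    have f_nonneg: "0 \<le> f k" for k
      using b_nonneg[of k] by (simp add: f_def)
    have sf: "summable f"
      by (rule summable_comparison_test'[OF summable_mult2[OF summ, of "\<mu> powr (1 / r)"]])
        (use f_le f_nonneg in auto)
    have f_head: "f k \<le> l + (ln \<mu> - ln (quot M k)) / r" if "k \<le> n" for k
      unfolding f_def b_def l_def using \<mu> quot_pos[OF M, of k] quot_pos[OF N, of k] C r
        quot_mono[OF M that] by (intro ln_1_plus_quotient_le) (auto simp: \<mu>_def)
    have f_first: "ln (1 + exp (ln \<mu> / r)) \<le> l + ln \<mu> / r"
      using f_head[of 0] by (simp add: f_def b_def)
    have "(\<Sum>k. f (k + Suc n)) \<le> (\<Sum>k. b (k + Suc n) * \<mu> powr (1 / r))"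
      using sf summ f_le
      by (intro suminf_le summable_mult2 summable_ignore_initial_segment) auto
    also have "\<dots> = \<mu> powr (1 / r) * (\<Sum>k. b (k + Suc n))"
      using suminf_mult2[OF summable_ignore_initial_segment[OF summ, of "Suc n"]]
      by (simp add: mult.commute)
    finally have f_tail: "(\<Sum>k. f (k + Suc n)) \<le> B * real n + S"
      using tail[of n] by (simp add: \<mu>_def)
    have "(\<Sum>k<Suc n. f k) \<le> (\<Sum>k<Suc n. l + (ln \<mu> - ln (quot M k)) / r)"
      using f_head by (intro sum_mono) auto
    also have "\<dots> = real (Suc n) * l + (real (Suc n) * ln \<mu> - (\<Sum>k<Suc n. ln (quot M k))) / r"
      by (simp add: sum.distrib sum_subtractf flip: sum_divide_distrib)
    also have "(\<Sum>k<Suc n. ln (quot M k)) = ln (M n)"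
    proof -
      have "(\<Sum>k<Suc n. ln (quot M k)) = (\<Sum>k=1..n. ln (quot M k))"
        unfolding lessThan_Suc_atMost atMost_atLeast0 by (subst sum.atLeast_Suc_atMost) auto
      also have "\<dots> = ln (\<Prod>k=1..n. quot M k)"
        by (intro ln_prod[symmetric] finite_atLeastAtMost less_imp_neq[symmetric] quot_pos[OF M])
      finally show ?thesis by (simp only: prod_quot[OF M])
    qed
    finally have "ln (1 + exp (ln \<mu> / r)) + (\<Sum>k. f k) \<le> l + ln \<mu> / r + (B * real n + S) +
        (real (Suc n) * l + (real (Suc n) * ln \<mu> - ln (M n)) / r)"
      using suminf_split_initial_segment[OF sf, of "Suc n"] f_tail f_first by linarith
    then have "r * (ln (1 + exp (ln \<mu> / r)) + (\<Sum>k. f k)) \<le> r * (l + ln \<mu> / r + (B * real n + S) +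
        (real (Suc n) * l + (real (Suc n) * ln \<mu> - ln (M n)) / r))"
      using r by (intro mult_left_mono) auto
    also have "\<dots> = ((r * B + r * l) * real n + (r * S + 2 * r * l)) + real (n + 2) * ln \<mu> - ln (M n)"
      using r by (simp add: field_simps)
    finally have "exp (- (((r * B + r * l) * real n + (r * S + 2 * r * l)) + real (n + 2) * ln \<mu> - ln (M n)))
        \<le> kernel_real (quot N) r (ln \<mu>)"
      by (simp add: kernel_real_def f_def b_def)
    moreover have "exp (- (X + real (n + 2) * ln \<mu> - ln (M n))) = exp (- X) * M n / \<mu> ^ (n + 2)" for X
    proof -
      have "exp (- (X + real (n + 2) * ln \<mu> - ln (M n))) = exp (- X) * exp (ln (M n)) / exp (real (n + 2) * ln \<mu>)"
        by (simp flip: exp_add exp_diff)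
      also have "exp (real (n + 2) * ln \<mu>) = \<mu> ^ (n + 2)"
        using \<mu> by (simp only: exp_of_nat_mult) simp
      finally show ?thesis using LC_pos[OF M, of n] by simp
    qed
    ultimately show ?thesis by (simp only: \<mu>_def)
  qed
  then show ?thesis by (rule that)
qed

text \<open>The kernel decreases, so the moment of order \<open>n\<close> is at least the value of the kernel at
  \<open>\<mu>\<^sub>n\<close> times \<open>\<mu>\<^sub>n\<^sup>n\<^sup>+\<^sup>1 / (n + 1)\<close>. The factor \<open>1 / \<mu>\<^sub>n\<close> that is lost against \<open>M\<^sub>n\<close> is geometric by
  moderate growth. The point \<open>x\<close> is \<open>ln \<mu>\<^sub>n\<close>.\<close>

lemma moments_lower_bound:
  assumes M: "M \<in> LC" and N: "N \<in> LC" and C: "1 \<le> C" "\<And>p. quot M p \<le> C * quot N p"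
    and r: "0 < r" and cond: "gamma_cond M N r" and mg: "moderate_growth M"
  obtains c A where "0 < c" "0 < A"
    "\<And>n. \<exists>x. c * A ^ n * M n \<le> kernel_real (quot N) r x * exp (real (Suc n) * x) / real (Suc n)"
proof -
  obtain D E where DE: "\<And>n. exp (- (D * real n + E)) * M n / quot M n ^ (n + 2)
      \<le> kernel_real (quot N) r (ln (quot M n))"
    using kernel_real_lower_bound[OF M N C r cond] by blast
  obtain B where B: "1 \<le> B" "\<And>n. quot M n \<le> M 1 * B ^ n"
    using quot_geometric_bound[OF M mg] by blast
  define c where "c = exp (- E) / M 1"
  define A where "A = exp (- D) / (2 * B)"
  have "c * A ^ n * M n \<le> kernel_real (quot N) r (ln (quot M n)) * exp (real (Suc n) * ln (quot M n)) / real (Suc n)"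
    for n
  proof -
    define \<mu> where "\<mu> = quot M n"
    have \<mu>: "0 < \<mu>" using quot_pos[OF M] by (simp add: \<mu>_def)
    have "real (Suc n) \<le> 2 ^ n"
      using less_exp[of n] by (metis Suc_leI of_nat_le_iff of_nat_numeral of_nat_power)
    then have "real (Suc n) * \<mu> \<le> 2 ^ n * (M 1 * B ^ n)"
      using B(2)[of n] \<mu> by (intro mult_mono) (auto simp: \<mu>_def)
    then have "exp (- (D * real n + E)) * M n / (2 ^ n * (M 1 * B ^ n))
        \<le> exp (- (D * real n + E)) * M n / (real (Suc n) * \<mu>)"
      using \<mu> LC_pos[OF M, of n] by (intro divide_left_mono) (auto intro!: mult_pos_pos LC_pos[OF M] simp: B(1) less_le_trans[OF _ B(1)])
    moreover have "c * A ^ n * M n = exp (- (D * real n + E)) * M n / (2 ^ n * (M 1 * B ^ n))"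
    proof -
      have "exp (- (D * real n + E)) = exp (- E) * exp (- D) ^ n"
        by (simp add: mult.commute flip: exp_add exp_of_nat_mult)
      then show ?thesis
        by (simp add: c_def A_def power_divide power_mult_distrib)
    qed
    moreover have "exp (- (D * real n + E)) * M n / (real (Suc n) * \<mu>)
        = exp (- (D * real n + E)) * M n / \<mu> ^ (n + 2) * \<mu> ^ Suc n / real (Suc n)"
      using \<mu> by (simp add: field_simps)
    moreover have "\<dots> \<le> kernel_real (quot N) r (ln \<mu>) * \<mu> ^ Suc n / real (Suc n)"
      using DE[of n] \<mu> by (intro divide_right_mono mult_right_mono) (auto simp: \<mu>_def)
    moreover have "\<mu> ^ Suc n = exp (real (Suc n) * ln \<mu>)"
      using \<mu> by (simp only: exp_of_nat_mult exp_ln)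
    ultimately show ?thesis by (simp only: \<mu>_def)
  qed
  moreover have "0 < c" "0 < A" using LC_pos[OF M, of 1] B(1) by (auto simp: c_def A_def)
  ultimately show ?thesis using that by blast
qed

section \<open>The extension operator\<close>

text \<open>With \<open>z = e\<^sup>w\<close> and \<open>P\<^sub>p\<close>, \<open>m\<^sub>p\<close> the incomplete and complete moments, this is
  \<open>\<Sum>p. (a\<^sub>p / p!) z\<^sup>p (P\<^sub>p(ln (R / z)) / m\<^sub>p)\<close>, a termwise form of the truncated Laplace transform
  \<open>z\<^sup>-\<^sup>1 \<integral> g(u) G(u / z) du\<close> over \<open>0 < u < R\<close>, where \<open>g(u) = \<Sum>p. a\<^sub>p / (p! m\<^sub>p) u\<^sup>p\<close>.\<close>

definition extension ::
  "(nat \<Rightarrow> complex \<Rightarrow> complex) \<Rightarrow> (nat \<Rightarrow> complex) \<Rightarrow> real \<Rightarrow> (nat \<Rightarrow> complex) \<Rightarrow> complex \<Rightarrow> complex" where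
  "extension P m R a w =
     (\<Sum>p. a p / (fact p * m p) * exp w ^ p * P p (of_real (ln R) - w))"

text \<open>The properties of the incomplete and complete moments on which the extension operator
  rests.\<close>

locale moment_system =
  fixes M N :: "nat \<Rightarrow> real" and r c A :: real
    and P :: "nat \<Rightarrow> complex \<Rightarrow> complex" and m :: "nat \<Rightarrow> complex"
  assumes r: "0 < r" and c: "0 < c" and A: "0 < A"
    and M_pos: "\<And>p. 0 < M p" and N_nonneg: "\<And>p. 0 \<le> N p" and N_0: "N 0 = 1"
    and hol: "\<And>p. P p holomorphic_on sector r"
    and below: "\<And>w n p. w \<in> sector r \<Longrightarrow> n \<le> p \<Longrightarrow>
      cmod (P p w) \<le> pi * N n * exp ((real p - real n) * Re w)"
    and above: "\<And>w n p. w \<in> sector r \<Longrightarrow> p < n \<Longrightarrow>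
      cmod (m p - P p w) \<le> pi * N n * exp ((real p - real n) * Re w)"
    and moment: "\<And>p. c * A ^ p * M p \<le> cmod (m p)"
begin

text \<open>The sequence lies in the weighted space of parameter \<open>1\<close> and has norm at most \<open>L\<close>.\<close>

definition coeff_bound :: "real \<Rightarrow> (nat \<Rightarrow> complex) \<Rightarrow> bool" where
  "coeff_bound L a \<longleftrightarrow> (\<forall>p. cmod (a p) \<le> L * (fact p * M p))"

text \<open>The summands of the extension for \<open>R = A / 2\<close>. The series \<open>g\<close> has radius of convergence at
  least \<open>A\<close>, and the factor \<open>1 / 2\<close> makes all series below geometric.\<close>

definition ext_term :: "(nat \<Rightarrow> complex) \<Rightarrow> nat \<Rightarrow> complex \<Rightarrow> complex" where
  "ext_term a p w = a p / (fact p * m p) * exp w ^ p * P p (of_real (ln (A / 2)) - w)"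

lemma moment_nonzero: "m p \<noteq> 0"
proof -
  have "0 < c * A ^ p * M p" using c A M_pos by simp
  then show ?thesis using moment[of p] by auto
qed

lemma reflect: "w \<in> sector r \<Longrightarrow> of_real x - w \<in> sector r"
  by (simp add: sector_def argument_def)

lemma coefficient_le:
  assumes "coeff_bound L a"
  shows "cmod (a p / (fact p * m p)) \<le> L / (c * A ^ p)"
proof -
  have pos: "0 < c * A ^ p * M p" using c A M_pos by simp
  have "cmod (a p / (fact p * m p)) = cmod (a p) / (fact p * cmod (m p))"
    by (simp add: norm_divide norm_mult)
  also have "\<dots> \<le> L * (fact p * M p) / (fact p * (c * A ^ p * M p))"
    using assms pos moment[of p] unfolding coeff_bound_def
    by (intro frac_le mult_left_mono) (auto intro: order_trans[OF norm_ge_zero])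
  also have "\<dots> = L / (c * A ^ p)"
    using M_pos[of p] by simp
  finally show ?thesis .
qed

text \<open>The summands with \<open>p \<ge> n\<close> and the errors in the summands with \<open>p < n\<close> obey the same bound,
  by the two estimates for the incomplete moments.\<close>

lemma remainder_term_le:
  assumes a: "coeff_bound L a" and w: "w \<in> sector r"
  shows "cmod (ext_term a p w - (if p < n then a p / fact p * exp w ^ p else 0))
    \<le> pi * L / c * N n * (2 / A * cmod (exp w)) ^ n * (1 / 2) ^ p"
proof -
  define v where "v = of_real (ln (A / 2)) - w"
  have v: "v \<in> sector r" "Re v = ln (A / 2) - Re w"
    using reflect[OF w] by (simp_all add: v_def)
  define d where "d = (if p < n then m p else 0)"
  have "cmod (P p v - d) \<le> pi * N n * exp ((real p - real n) * Re v)"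
    using below[OF v(1), of n p] above[OF v(1), of p n]
    by (simp add: d_def norm_minus_commute)
  moreover have "exp ((real p - real n) * Re v) = (A / 2) ^ p * (2 / A * exp (Re w)) ^ n / exp (Re w) ^ p"
  proof -
    have "exp (real k * Re v) = (A / 2 / exp (Re w)) ^ k" for k
      using A by (simp add: v(2) exp_of_nat_mult exp_diff)
    then have "exp ((real p - real n) * Re v) = (A / 2 / exp (Re w)) ^ p / (A / 2 / exp (Re w)) ^ n"
      by (simp add: left_diff_distrib exp_diff)
    also have "\<dots> = (A / 2) ^ p * (2 / A * exp (Re w)) ^ n / exp (Re w) ^ p"
      using A by (simp add: power_divide power_mult_distrib field_simps)
    finally show ?thesis .
  qed
  ultimately have "cmod (P p v - d)
      \<le> pi * N n * ((A / 2) ^ p * (2 / A * exp (Re w)) ^ n / exp (Re w) ^ p)"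
    by simp
  moreover have "ext_term a p w - (if p < n then a p / fact p * exp w ^ p else 0)
      = a p / (fact p * m p) * exp w ^ p * (P p v - d)"
    using moment_nonzero[of p] by (simp add: ext_term_def d_def v_def right_diff_distrib)
  moreover have "0 \<le> L / (c * A ^ p)"
    using coefficient_le[OF a, of p] norm_ge_zero order_trans by blast
  ultimately have "cmod (ext_term a p w - (if p < n then a p / fact p * exp w ^ p else 0))
      \<le> L / (c * A ^ p) * exp (Re w) ^ p *
        (pi * N n * ((A / 2) ^ p * (2 / A * exp (Re w)) ^ n / exp (Re w) ^ p))"
    using coefficient_le[OF a, of p]
    by (simp only: norm_mult norm_power norm_exp_eq_Re)
      (intro mult_mono mult_nonneg_nonneg; (assumption | simp))
  also have "\<dots> = pi * L / c * N n * (2 / A * cmod (exp w)) ^ n * (1 / 2) ^ p"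
    using A c by (simp add: power_divide mult_ac)
  finally show ?thesis .
qed

lemma ext_term_le:
  assumes "coeff_bound L a" "w \<in> sector r"
  shows "cmod (ext_term a p w) \<le> pi * L / c * (1 / 2) ^ p"
  using remainder_term_le[OF assms, of p 0] by (simp add: N_0)

lemma ext_summable:
  assumes "coeff_bound L a" "w \<in> sector r"
  shows "summable (\<lambda>p. ext_term a p w)"
proof (rule summable_comparison_test')
  show "summable (\<lambda>p. pi * L / c * (1 / 2) ^ p)"
    by (intro summable_mult summable_geometric) simp
qed (rule ext_term_le[OF assms])

lemma extension_eq: "extension P m (A / 2) a w = (\<Sum>p. ext_term a p w)"
  by (simp add: extension_def ext_term_def)

lemma extension_holomorphic:
  assumes a: "coeff_bound L a"
  shows "extension P m (A / 2) a holomorphic_on sector r"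
proof -
  have "(\<lambda>w. \<Sum>p. ext_term a p w) holomorphic_on sector r"
  proof (rule holomorphic_suminf[OF open_sector, where \<phi> = "\<lambda>_. pi * L / c"])
    show "ext_term a p holomorphic_on sector r" for p
    proof -
      have "(\<lambda>w. P p (of_real (ln (A / 2)) - w)) holomorphic_on sector r"
        using reflect
        by (intro holomorphic_on_compose_gen[OF _ hol[of p], unfolded o_def] holomorphic_intros) auto
      then show ?thesis
        unfolding ext_term_def[abs_def] by (intro holomorphic_intros)
    qed
    show "summable (\<lambda>p. (1 / 2) ^ p :: real)" by (intro summable_geometric) simp
    show "cmod (ext_term a p w) \<le> (1 / 2) ^ p * (pi * L / c)" if "w \<in> sector r" for p w
      using ext_term_le[OF a that, of p] by (simp add: mult.commute)
  qed auto
  then show ?thesis by (simp add: extension_eq[abs_def])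
qed

lemma extension_remainder:
  assumes a: "coeff_bound L a" and w: "w \<in> sector r"
  shows "cmod (extension P m (A / 2) a w - (\<Sum>p<n. a p / fact p * exp w ^ p))
    \<le> 2 * pi * L / c * N n * (2 / A * cmod (exp w)) ^ n"
proof -
  define K where "K = pi * L / c * N n * (2 / A * cmod (exp w)) ^ n"
  define t where "t p = (if p < n then a p / fact p * exp w ^ p else 0)" for p
  have t: "t sums (\<Sum>p<n. a p / fact p * exp w ^ p)"
    unfolding t_def using sums_If_finite_set[of "{..<n}" "\<lambda>p. a p / fact p * exp w ^ p"] by simp
  have le: "cmod (ext_term a p w - t p) \<le> K * (1 / 2) ^ p" for p
    using remainder_term_le[OF a w] by (simp add: K_def t_def)
  have geo: "(\<lambda>p. K * (1 / 2) ^ p) sums (2 * K)"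
    using sums_mult[OF geometric_sums[of "1 / 2 :: real"], of K] by (simp add: mult.commute[of K 2])
  have "(\<lambda>p. ext_term a p w - t p) sums
      (extension P m (A / 2) a w - (\<Sum>p<n. a p / fact p * exp w ^ p))"
    unfolding extension_eq using summable_sums[OF ext_summable[OF a w]] t by (rule sums_diff)
  then have "extension P m (A / 2) a w - (\<Sum>p<n. a p / fact p * exp w ^ p)
      = (\<Sum>p. ext_term a p w - t p)"
    by (rule sums_unique)
  also have "cmod \<dots> \<le> (\<Sum>p. K * (1 / 2) ^ p)"
    using le geo by (intro norm_suminf_le) (auto dest: sums_summable)
  also have "\<dots> = 2 * K" using geo by (rule sums_unique[symmetric])
  finally show ?thesis by (simp add: K_def)
qed

end

lemma moment_system_exists:
  assumes M: "M \<in> LC" and N: "N \<in> LC" and C: "1 \<le> C" "\<And>p. quot M p \<le> C * quot N p"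
    and r: "0 < r" and cond: "gamma_cond M N r" and mg: "moderate_growth M"
  obtains c A P m where "moment_system M N r c A P m"
proof -
  obtain c A where c: "0 < c" "0 < A" and lower:
    "\<And>n. \<exists>x. c * A ^ n * M n \<le> kernel_real (quot N) r x * exp (real (Suc n) * x) / real (Suc n)"
    using moments_lower_bound[OF M N C r cond mg] by blast
  have summ: "summable (\<lambda>k. (1 / quot N k) powr (1 / r))"
    using cond by (simp add: gamma_cond_def)
  note ker = r quot_pos[OF N] summ
  have "\<exists>Q l. Q holomorphic_on sector r \<and>
    (\<forall>w\<in>sector r. \<forall>n\<le>p. cmod (Q w) \<le> pi * N n * exp ((real p - real n) * Re w)) \<and>
    (\<forall>w\<in>sector r. \<forall>n>p. cmod (l - Q w) \<le> pi * N n * exp ((real p - real n) * Re w)) \<and>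
    (\<forall>x. kernel_real (quot N) r x * exp (real (Suc p) * x) / real (Suc p) \<le> Re l)" for p
  proof (rule incomplete_moments)
    show "kernel (quot N) r holomorphic_on sector r" by (rule kernel_holomorphic[OF ker])
    show "cmod (kernel (quot N) r w) \<le> N n * exp (- real n * Re w) * min 1 (exp (- 2 * Re w))"
      if "w \<in> sector r" for w n
      using norm_kernel_le[OF ker that quot_0] unfolding prod_quot[OF N] .
    show "kernel (quot N) r (of_real x) = of_real (kernel_real (quot N) r x)" for x
      by (rule kernel_of_real[OF ker])
    show "kernel_real (quot N) r y \<le> kernel_real (quot N) r x" if "x \<le> y" for x y
      using that by (rule kernel_real_antimono[OF ker])
  qed (use r LC_pos[OF N] kernel_real_pos in \<open>auto intro: less_imp_le\<close>)
  then obtain P m where P: "\<And>p. P p holomorphic_on sector r"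
    "\<And>p w n. w \<in> sector r \<Longrightarrow> n \<le> p \<Longrightarrow> cmod (P p w) \<le> pi * N n * exp ((real p - real n) * Re w)"
    "\<And>p w n. w \<in> sector r \<Longrightarrow> p < n \<Longrightarrow> cmod (m p - P p w) \<le> pi * N n * exp ((real p - real n) * Re w)"
    "\<And>p x. kernel_real (quot N) r x * exp (real (Suc p) * x) / real (Suc p) \<le> Re (m p)"
    by metis
  have "moment_system M N r c A P m"
  proof
    show "c * A ^ p * M p \<le> cmod (m p)" for p
      using lower[of p] P(4)[of _ p] complex_Re_le_cmod[of "m p"] by (meson order_trans)
  qed (use r c P LC_pos[OF M] LC_pos[OF N] LC_0[OF N] in \<open>auto intro: less_imp_le\<close>)
  then show ?thesis by (rule that)
qed

section \<open>The weighted spaces\<close>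

lemma seq_space_bound:
  assumes "a \<in> seq_space M h" "0 < h" "\<And>p. 0 < M p"
  shows "cmod (a p) \<le> seq_norm M h a * (h ^ p * M p)" "0 \<le> seq_norm M h a"
proof -
  have le: "cmod (a p) / (h ^ p * M p) \<le> seq_norm M h a" for p
    using assms(1) unfolding seq_norm_def seq_space_def by (intro cSUP_upper) auto
  then show "cmod (a p) \<le> seq_norm M h a * (h ^ p * M p)"
    using assms(2,3) by (simp add: pos_divide_le_eq)
  have "0 \<le> cmod (a 0) / (h ^ 0 * M 0)"
    using assms(3)[of 0] by simp
  then show "0 \<le> seq_norm M h a"
    using le order_trans by blast
qed

lemma seq_space_I:
  assumes "0 < h" "\<And>p. 0 < M p" "\<And>p. cmod (a p) \<le> L * (h ^ p * M p)"
  shows "a \<in> seq_space M h"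
  unfolding seq_space_def bdd_above_def using assms by (auto simp: pos_divide_le_eq)

lemma seq_space_diff:
  assumes "a \<in> seq_space M h" "b \<in> seq_space M h" "0 < h" "\<And>p. 0 < M p"
  shows "(\<lambda>p. a p - b p) \<in> seq_space M h"
proof (rule seq_space_I)
  show "cmod (a p - b p) \<le> (seq_norm M h a + seq_norm M h b) * (h ^ p * M p)" for p
    using norm_triangle_ineq4[of "a p" "b p"] seq_space_bound(1)[OF assms(1,3,4), of p]
      seq_space_bound(1)[OF assms(2,3,4), of p] by (simp add: distrib_right)
qed (use assms in auto)

lemma fun_space_I:
  assumes S: "open S" "S \<noteq> {}" and h: "0 < h" and M: "\<And>p. 0 < M p"
    and F: "F holomorphic_on S" and f: "\<And>w. w \<in> S \<Longrightarrow> f w = F w" "\<And>w. w \<notin> S \<Longrightarrow> f w = 0"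
    and bound: "\<And>w p. w \<in> S \<Longrightarrow> cmod ((surf_deriv ^^ p) F w) \<le> L * (h ^ p * M p)"
  shows "f \<in> fun_space M h S" "fun_norm M h S f \<le> L"
proof -
  have le: "cmod ((surf_deriv ^^ p) f w) / (h ^ p * M p) \<le> L" if "w \<in> S" for w p
    using bound[OF that, of p] surf_deriv_cong[OF S(1) f(1) that, where n = p] h M[of p]
    by (simp add: pos_divide_le_eq)
  have "f holomorphic_on S" using F f(1) by (simp cong: holomorphic_cong)
  then show "f \<in> fun_space M h S"
    unfolding fun_space_def using surf_holomorphic_on_iff[OF S(1)] f(2) le
    by (auto intro!: bdd_aboveI2[where M = L])
  show "fun_norm M h S f \<le> L"
    unfolding fun_norm_def using S(2) le by (intro cSUP_least) auto
qed

section \<open>Existence of right inverses of the Borel map\<close>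

theorem theorem5p12:
  fixes M N :: "nat \<Rightarrow> real" and C \<gamma> :: real
  assumes "M \<in> LC" and "N \<in> LC"
    and "C \<ge> 1" and "\<And>p. quot M p \<le> C * quot N p"
    and "moderate_growth M"
    and "growth_index M N > 0"
    and "0 < \<gamma>" and "ereal \<gamma> < growth_index M N"
  shows "(\<exists>k1>0. \<forall>h>0. \<exists>E :: (nat \<Rightarrow> complex) \<Rightarrow> (log_surface \<Rightarrow> complex).
            clinear_between (seq_space (fact_mult M) h)
              (fun_space (fact_mult N) (k1 * h) (sector \<gamma>)) E
            \<and> norm_continuous_on (seq_space (fact_mult M) h)
              (seq_norm (fact_mult M) h) (fun_norm (fact_mult N) (k1 * h) (sector \<gamma>)) E
            \<and> (\<forall>a \<in> seq_space (fact_mult M) h.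
                 has_boundary_derivs (sector \<gamma>) (E a) a \<and> borel_map (sector \<gamma>) (E a) = a))
         \<and> seq_space_union (fact_mult M)
             \<subseteq> borel_map (sector \<gamma>) ` fun_space_union (fact_mult N) (sector \<gamma>)"
proof -
  obtain r where rg: "\<gamma> < r" "gamma_cond M N r"
  proof -
    obtain x where "x \<in> insert 0 (ereal ` {r. 0 < r \<and> gamma_cond M N r})" "ereal \<gamma> < x"
      using assms(8) unfolding growth_index_def less_Sup_iff by blast
    then show ?thesis using \<open>0 < \<gamma>\<close> that by auto
  qed
  have r0: "0 < r" using rg(1) \<open>0 < \<gamma>\<close> by simp
  obtain c A P m where ms: "moment_system M N r c A P m"
    using moment_system_exists[OF assms(1-4) r0 rg(2) assms(5)] .
  interpret moment_system M N r c A P m by (rule ms)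
  \<comment> \<open>The constants below depend on \<open>r\<close>, \<open>\<gamma>\<close> and \<open>A\<close> only, hence not on \<open>h\<close>.\<close>
  define \<delta> where "\<delta> = min (1 / 4) ((r - \<gamma>) * pi / 8)"
  have \<delta>: "0 < \<delta>" "\<delta> \<le> 1 / 4" "4 * \<delta> \<le> (r - \<gamma>) * pi / 2"
  proof -
    have "0 < (r - \<gamma>) * pi / 8"
      using rg(1) by (intro divide_pos_pos mult_pos_pos) auto
    then show "0 < \<delta>" "\<delta> \<le> 1 / 4" by (simp_all add: \<delta>_def)
    have "\<delta> \<le> (r - \<gamma>) * pi / 8" by (simp add: \<delta>_def)
    then show "4 * \<delta> \<le> (r - \<gamma>) * pi / 2" by simp
  qed
  define k1 where "k1 = 4 / (A * \<delta>)"
  have k1: "0 < k1" using A \<delta> by (simp add: k1_def)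
  have N_pos: "0 < N p" for p by (rule LC_pos[OF assms(2)])
  have fM: "0 < fact_mult M p" and fN: "0 < fact_mult N p" for p
    using M_pos N_pos by (simp_all add: fact_mult_def)
  have sector_ne: "sector \<gamma> \<noteq> {}"
  proof -
    have "0 \<in> sector \<gamma>" using \<open>0 < \<gamma>\<close> by (simp add: sector_def argument_def)
    then show ?thesis by blast
  qed
  have sub: "w \<in> sector r" if "w \<in> sector \<gamma>" for w
  proof -
    have "\<gamma> * pi / 2 \<le> r * pi / 2" using rg(1) by simp
    then show ?thesis using that unfolding sector_def mem_Collect_eq by linarith
  qed
  have main: "\<exists>E :: (nat \<Rightarrow> complex) \<Rightarrow> (log_surface \<Rightarrow> complex).
      clinear_between (seq_space (fact_mult M) h) (fun_space (fact_mult N) (k1 * h) (sector \<gamma>)) E \<and>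
      norm_continuous_on (seq_space (fact_mult M) h) (seq_norm (fact_mult M) h)
        (fun_norm (fact_mult N) (k1 * h) (sector \<gamma>)) E \<and>
      (\<forall>a \<in> seq_space (fact_mult M) h.
         has_boundary_derivs (sector \<gamma>) (E a) a \<and> borel_map (sector \<gamma>) (E a) = a)"
    if h: "0 < h" for h
  proof -
    let ?V = "seq_space (fact_mult M) h" and ?nV = "seq_norm (fact_mult M) h"
    let ?W = "fun_space (fact_mult N) (k1 * h) (sector \<gamma>)"
    let ?nW = "fun_norm (fact_mult N) (k1 * h) (sector \<gamma>)"
    \<comment> \<open>The dilation \<open>z \<mapsto> h z\<close> preserves the sectors and reduces the construction to parameter 1.\<close>
    define sc where "sc a p = a p / of_real h ^ p" for a :: "nat \<Rightarrow> complex" and p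
    define F where "F a w = extension P m (A / 2) (sc a) (w + of_real (ln h))" for a w
    define E where "E a w = (if w \<in> sector \<gamma> then F a w else 0)" for a w
    define K where "K = 2 * pi / c"
    have K: "0 \<le> K" using c by (simp add: K_def)
    have shift: "w + of_real (ln h) \<in> sector r" if "w \<in> sector r" for w
      using that by (simp add: sector_def argument_def)
    have sc_bound: "coeff_bound (?nV a) (sc a)" if "a \<in> ?V" for a
      unfolding coeff_bound_def
    proof
      fix p
      have "cmod (a p) \<le> ?nV a * (h ^ p * fact_mult M p)"
        using that h fM by (rule seq_space_bound(1))
      then show "cmod (sc a p) \<le> ?nV a * (fact p * M p)"
        using h by (simp add: sc_def norm_divide norm_power pos_divide_le_eq fact_mult_def mult_ac)
    qed
    have hol_F: "F a holomorphic_on sector r" if "a \<in> ?V" for a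
      unfolding F_def[abs_def] using shift
      by (intro holomorphic_on_compose_gen[OF _ extension_holomorphic[OF sc_bound[OF that]], unfolded o_def]
          holomorphic_intros) auto
    have rem: "cmod (F a w - (\<Sum>p<n. a p / fact p * exp w ^ p))
        \<le> (K * ?nV a * N n * (2 * h / A) ^ n) * cmod (exp w) ^ n"
      if "a \<in> ?V" "w \<in> sector r" for a w n
    proof -
      have e: "exp (w + of_real (ln h)) = exp w * of_real h"
        using h by (simp add: exp_add exp_of_real)
      have "sc a p / fact p * exp (w + of_real (ln h)) ^ p = a p / fact p * exp w ^ p" for p
        using h unfolding e sc_def by (simp add: power_mult_distrib)
      then have "cmod (F a w - (\<Sum>p<n. a p / fact p * exp w ^ p))
          \<le> 2 * pi * ?nV a / c * N n * (2 / A * cmod (exp w * of_real h)) ^ n"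
        using extension_remainder[OF sc_bound[OF that(1)] shift[OF that(2)], of n]
        unfolding F_def e by simp
      also have "\<dots> = (K * ?nV a * N n * (2 * h / A) ^ n) * cmod (exp w) ^ n"
        using h by (simp add: K_def norm_mult power_divide power_mult_distrib mult_ac)
      finally show ?thesis .
    qed
    have deriv_bound: "cmod ((surf_deriv ^^ n) (F a) w) \<le> K * ?nV a * ((k1 * h) ^ n * fact_mult N n)"
      if a: "a \<in> ?V" and w: "w \<in> sector \<gamma>" for a w n
    proof -
      have "cmod ((surf_deriv ^^ n) (F a) w)
          \<le> fact n * (K * ?nV a * N n * (2 * h / A) ^ n * (2 * cmod (exp w)) ^ n) / (\<delta> * cmod (exp w)) ^ n"
        using surf_deriv_Cauchy[OF hol_F[OF a] \<delta> rem[OF a] w, of n n] by simp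
      also have "\<dots> = K * ?nV a * ((k1 * h) ^ n * fact_mult N n)"
      proof -
        define e where "e = cmod (exp w)"
        have e: "0 < e" by (simp add: e_def)
        have "2 * h / A * (2 * e) / (\<delta> * e) = k1 * h"
          using A \<delta>(1) e by (simp add: k1_def)
        then have "(2 * h / A) ^ n * (2 * e) ^ n / (\<delta> * e) ^ n = (k1 * h) ^ n"
          by (metis power_mult_distrib power_divide)
        moreover have "fact n * (K * ?nV a * N n * (2 * h / A) ^ n * (2 * e) ^ n) / (\<delta> * e) ^ n
            = K * ?nV a * ((2 * h / A) ^ n * (2 * e) ^ n / (\<delta> * e) ^ n * (fact n * N n))"
          by (simp only: times_divide_eq_left times_divide_eq_right mult_ac)
        ultimately show ?thesis by (simp only: fact_mult_def flip: e_def)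
      qed
      finally show ?thesis .
    qed
    have E_F: "(surf_deriv ^^ n) (E a) w = (surf_deriv ^^ n) (F a) w" if "w \<in> sector \<gamma>" for n a w
      using that by (intro surf_deriv_cong[OF open_sector]) (auto simp: E_def)
    have hol_F': "F a holomorphic_on sector \<gamma>" if "a \<in> ?V" for a
      using hol_F[OF that] sub by (meson holomorphic_on_subset subsetI)
    have E_W: "E a \<in> ?W" and E_norm: "?nW (E a) \<le> K * ?nV a" if "a \<in> ?V" for a
      using fun_space_I[OF open_sector sector_ne _ fN hol_F'[OF that] _ _ deriv_bound[OF that], of "E a"]
        k1 h by (auto simp: E_def)
    have summ: "summable (\<lambda>p. ext_term (sc a) p (w + of_real (ln h)))"
      if "a \<in> ?V" "w \<in> sector \<gamma>" for a w
      using ext_summable[OF sc_bound[OF that(1)] shift[OF sub[OF that(2)]]] .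
    have add: "E (\<lambda>p. a p + b p) = (\<lambda>w. E a w + E b w)" if "a \<in> ?V" "b \<in> ?V" for a b
    proof
      fix w
      have t: "ext_term (sc (\<lambda>p. a p + b p)) p v = ext_term (sc a) p v + ext_term (sc b) p v" for p v
        by (simp add: ext_term_def sc_def add_divide_distrib distrib_right)
      show "E (\<lambda>p. a p + b p) w = E a w + E b w"
        using suminf_add[OF summ[OF that(1)] summ[OF that(2)], of w]
        by (simp add: E_def F_def extension_eq t)
    qed
    have scale: "E (\<lambda>p. x * a p) = (\<lambda>w. x * E a w)" if "a \<in> ?V" for a x
    proof
      fix w
      have t: "ext_term (sc (\<lambda>p. x * a p)) p v = x * ext_term (sc a) p v" for p v
        by (simp add: ext_term_def sc_def)
      show "E (\<lambda>p. x * a p) w = x * E a w"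
        using suminf_mult[OF summ[OF that], of w x]
        by (simp add: E_def F_def extension_eq t)
    qed
    have diff: "(\<lambda>w. E b w - E a w) = E (\<lambda>p. b p - a p)" if "a \<in> ?V" "b \<in> ?V" for a b
      using add[OF seq_space_diff[OF that(2,1) h fM] that(1)] by (auto simp: fun_eq_iff)
    have "norm_continuous_on ?V ?nV ?nW E"
      unfolding norm_continuous_on_def
    proof (intro ballI allI impI)
      fix a and e :: real assume a: "a \<in> ?V" and e: "0 < e"
      show "\<exists>d>0. \<forall>b\<in>?V. ?nV (\<lambda>i. b i - a i) < d \<longrightarrow> ?nW (\<lambda>j. E b j - E a j) < e"
      proof (intro exI conjI ballI impI)
        show "0 < e / (K + 1)" using e K by simp
        fix b assume b: "b \<in> ?V" and lt: "?nV (\<lambda>i. b i - a i) < e / (K + 1)"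
        have d: "(\<lambda>i. b i - a i) \<in> ?V" by (rule seq_space_diff[OF b a h fM])
        have "?nW (\<lambda>j. E b j - E a j) \<le> K * ?nV (\<lambda>i. b i - a i)"
          unfolding diff[OF a b] by (rule E_norm[OF d])
        also have "\<dots> \<le> (K + 1) * ?nV (\<lambda>i. b i - a i)"
          using seq_space_bound(2)[OF d h fM] by (simp add: distrib_right)
        also have "\<dots> < e" using lt K by (simp add: pos_less_divide_eq mult.commute)
        finally show "?nW (\<lambda>j. E b j - E a j) < e" .
      qed
    qed
    moreover have "has_boundary_derivs (sector \<gamma>) (E a) a" if a: "a \<in> ?V" for a
      unfolding has_boundary_derivs_def
    proof
      fix n
      define B where "B = K * ?nV a * N (Suc n) * (2 * h / A) ^ Suc n"
      show "((surf_deriv ^^ n) (E a) \<longlongrightarrow> a n) (to_zero_in (sector \<gamma>))"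
      proof (rule tendsto_to_zero_in)
        fix w assume w: "w \<in> sector \<gamma>"
        have "cmod ((surf_deriv ^^ n) (F a) w - a n)
            \<le> fact n * (B * (2 * cmod (exp w)) ^ Suc n) / (\<delta> * cmod (exp w)) ^ n"
          using surf_deriv_Cauchy[OF hol_F[OF a] \<delta> rem[OF a] w, of "Suc n" n] by (simp add: B_def)
        also have "\<dots> = fact n * B * 2 * (2 / \<delta>) ^ n * cmod (exp w)"
          using \<delta> by (simp add: power_mult_distrib power_divide)
        finally show "cmod ((surf_deriv ^^ n) (E a) w - a n)
            \<le> fact n * B * 2 * (2 / \<delta>) ^ n * cmod (exp w)"
          by (simp only: E_F[OF w])
      qed
    qed
    moreover from this have "borel_map (sector \<gamma>) (E a) = a" if "a \<in> ?V" for a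
      using that to_zero_in_sector_neq_bot[OF \<open>0 < \<gamma>\<close>]
      unfolding has_boundary_derivs_def borel_map_def by (auto intro!: tendsto_Lim)
    moreover have "clinear_between ?V ?W E"
      unfolding clinear_between_def using E_W add scale by blast
    ultimately show ?thesis by blast
  qed
  have "seq_space_union (fact_mult M) \<subseteq> borel_map (sector \<gamma>) ` fun_space_union (fact_mult N) (sector \<gamma>)"
  proof
    fix a assume "a \<in> seq_space_union (fact_mult M)"
    then obtain h where h: "0 < h" "a \<in> seq_space (fact_mult M) h"
      by (auto simp: seq_space_union_def)
    then obtain f where "f \<in> fun_space (fact_mult N) (k1 * h) (sector \<gamma>)" "borel_map (sector \<gamma>) f = a"
      using main[OF h(1)] unfolding clinear_between_def by blast
    moreover have "0 < k1 * h" using k1 h by simp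
    ultimately show "a \<in> borel_map (sector \<gamma>) ` fun_space_union (fact_mult N) (sector \<gamma>)"
      unfolding fun_space_union_def by blast
  qed
  with main k1 show ?thesis by blast
qed

end
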